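(* Let $\alpha>0$, $T_0>0$, and let $u$ be a smooth solution of the equivariant Skyrme equation \[ \Big(1+\tfrac{\alpha^2\sin^2u}{r^2}\Big)(u_{tt}-u_{rr}) - \Big(1-\tfrac{\alpha^2\sin^2u}{r^2}\Big)\tfrac{u_r}{r} + \tfrac{\sin 2u}{2r^2}\big[\alpha^2(u_t^2-u_r^2)+1\big]=0 \] in $\Omega=\{(t,r):0<t\le T_0,\ 0\le r\le t\}$ (for $r>0$), with $u(t,0)=0$. Then the energy does not concentrate at the origin: \[ \lim_{T\to0^+}\int_0^T\Big[\Big(1+\tfrac{\alpha^2\sin^2u(T,r)}{r^2}\Big)\tfrac{u_t(T,r)^2+u_r(T,r)^2}{2}+\tfrac{\sin^2u(T,r)}{2r^2}\Big]\,r\,dr=0. \]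
   Context: $u=u(t,r)$ is the longitudinal angle of a co-rotational (index 1) equivariant map $U(t,r,\omega)=(u(t,r),\omega)$ from $\mathbb{R}^{2+1}$ to $\mathbb{S}^2$, where $(r,\omega)$ are polar coordinates on $\mathbb{R}^2$; "smooth solution in $\Omega$" means $u$ is smooth on $\Omega$, satisfies the equation for $r>0$, and $u(t,0)=0$. *)

theory Defs
  imports "HOL-Analysis.Analysis"
begin

fun Ck_on :: "nat \<Rightarrow> (real \<times> real \<Rightarrow> real) \<Rightarrow> (real \<times> real) set \<Rightarrow> bool" where
  "Ck_on 0 f U = continuous_on U f"
| "Ck_on (Suc k) f U =
     (\<exists>g h. (\<forall>x\<in>U. (f has_derivative (\<lambda>(a, b). a * g x + b * h x)) (at x))
            \<and> Ck_on k g U \<and> Ck_on k h U)"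

definition smooth_open :: "(real \<times> real \<Rightarrow> real) \<Rightarrow> (real \<times> real) set \<Rightarrow> bool" where
  "smooth_open f U \<longleftrightarrow> open U \<and> (\<forall>k. Ck_on k f U)"

definition smooth_on_set :: "(real \<Rightarrow> real \<Rightarrow> real) \<Rightarrow> (real \<times> real) set \<Rightarrow> bool" where
  "smooth_on_set u S \<longleftrightarrow> (\<exists>U. S \<subseteq> U \<and> smooth_open (\<lambda>(t, r). u t r) U)"

definition dt :: "(real \<Rightarrow> real \<Rightarrow> real) \<Rightarrow> real \<Rightarrow> real \<Rightarrow> real" where
  "dt u t r = deriv (\<lambda>s. u s r) t"

definition dr :: "(real \<Rightarrow> real \<Rightarrow> real) \<Rightarrow> real \<Rightarrow> real \<Rightarrow> real" where
  "dr u t r = deriv (\<lambda>s. u t s) r"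

definition Omega :: "real \<Rightarrow> (real \<times> real) set" where
  "Omega T0 = {(t, r). 0 < t \<and> t \<le> T0 \<and> 0 \<le> r \<and> r \<le> t}"

definition skyrme_eq :: "real \<Rightarrow> (real \<Rightarrow> real \<Rightarrow> real) \<Rightarrow> real \<Rightarrow> real \<Rightarrow> bool" where
  "skyrme_eq \<alpha> u t r \<longleftrightarrow>
     (1 + \<alpha>\<^sup>2 * (sin (u t r))\<^sup>2 / r\<^sup>2) * (dt (dt u) t r - dr (dr u) t r)
     - (1 - \<alpha>\<^sup>2 * (sin (u t r))\<^sup>2 / r\<^sup>2) * dr u t r / r
     + sin (2 * u t r) / (2 * r\<^sup>2) * (\<alpha>\<^sup>2 * ((dt u t r)\<^sup>2 - (dr u t r)\<^sup>2) + 1) = 0"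

definition energy_density :: "real \<Rightarrow> (real \<Rightarrow> real \<Rightarrow> real) \<Rightarrow> real \<Rightarrow> real \<Rightarrow> real" where
  "energy_density \<alpha> u t r =
     (1 + \<alpha>\<^sup>2 * (sin (u t r))\<^sup>2 / r\<^sup>2) * ((dt u t r)\<^sup>2 + (dr u t r)\<^sup>2) / 2
     + (sin (u t r))\<^sup>2 / (2 * r\<^sup>2)"

end

theory Submission
  imports Defs "HOL-Real_Asymp.Real_Asymp"
begin

text \<open>
  Put \<open>k = sin u / r\<close> and \<open>q = \<alpha>\<^sup>2 k\<^sup>2\<close>. The energy \<open>E t\<close> in the disc \<open>r \<le> t\<close> is nondecreasing, its
  derivative being the flux through the cone; let \<open>E0\<close> be its limit at \<open>0\<close>. By Cauchy--Schwarz the Skyrme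
  term of the energy controls \<open>1 - cos u \<le> const r\<close> uniformly in time, so that the potential energy in the
  disc \<open>r \<le> t\<close> is \<open>O(t)\<close> and only the four kinetic terms \<open>u\<^sub>t\<^sup>2\<close>, \<open>u\<^sub>r\<^sup>2\<close>, \<open>q u\<^sub>t\<^sup>2\<close>, \<open>q u\<^sub>r\<^sup>2\<close> matter.

  Fix \<open>S > 0\<close> and put \<open>\<tau> = t + S\<close>. The multiplier \<open>log (\<tau> / (\<tau> - r)) u\<^sub>r\<close> has a bulk term that is coercive
  in \<open>u\<^sub>t\<^sup>2 + q u\<^sub>r\<^sup>2\<close>; the multiplier \<open>(3 sin u / (1 + q) - sin u) / \<tau>\<close> controls \<open>u\<^sub>r\<^sup>2 + q u\<^sub>t\<^sup>2\<close> in
  terms of these. Adding 24 times the former to the latter yields a moment \<open>M t\<close>, bounded at \<open>t = S\<close> and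
  \<open>t = T\<close> uniformly in \<open>S\<close>, whose derivative is at most \<open>- E t / \<tau>\<close> up to flux and potential terms.
  Integrating over \<open>S \<le> t \<le> T\<close>, one finds that \<open>\<integral> E t / \<tau> dt\<close>, which is at least about
  \<open>E0 log (T / S)\<close>, is bounded by \<open>(24 (E T - E0) + O(T)) log (T / S) + O(1)\<close>. Letting first \<open>S\<close> and then
  \<open>T\<close> tend to \<open>0\<close> gives \<open>E0 = 0\<close>.
\<close>

section \<open>Functions with continuous partial derivatives\<close>

definition has_cont_partials ::
    "(real \<times> real \<Rightarrow> real) \<Rightarrow> (real \<times> real \<Rightarrow> real) \<Rightarrow> (real \<times> real \<Rightarrow> real) \<Rightarrow> (real \<times> real) set \<Rightarrow> bool" where
  "has_cont_partials f fx fy A \<longleftrightarrow>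
     (\<forall>z\<in>A. (f has_derivative (\<lambda>h. fst h * fx z + snd h * fy z)) (at z within A)) \<and>
     continuous_on A fx \<and> continuous_on A fy"

lemma has_cont_partialsI:
  assumes "\<And>z. z \<in> A \<Longrightarrow> (f has_derivative (\<lambda>h. fst h * fx z + snd h * fy z)) (at z within A)"
    and "continuous_on A fx" "continuous_on A fy"
  shows "has_cont_partials f fx fy A"
  using assms by (simp add: has_cont_partials_def)

lemma has_cont_partials_has_derivative:
  assumes "has_cont_partials f fx fy A" "z \<in> A"
  shows "(f has_derivative (\<lambda>h. fst h * fx z + snd h * fy z)) (at z within A)"
  using assms by (simp add: has_cont_partials_def)

lemma has_cont_partials_continuous_on:
  assumes "has_cont_partials f fx fy A"
  shows "continuous_on A f" "continuous_on A fx" "continuous_on A fy"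
  using assms by (auto simp: has_cont_partials_def intro: has_derivative_continuous_on)

lemma has_cont_partials_subset:
  assumes "has_cont_partials f fx fy A" "B \<subseteq> A"
  shows "has_cont_partials f fx fy B"
  using assms by (auto simp: has_cont_partials_def intro: continuous_on_subset has_derivative_subset)

lemma has_cont_partials_cong:
  assumes f: "has_cont_partials f fx fy A" and eq: "\<And>z. z \<in> A \<Longrightarrow> g z = f z"
  shows "has_cont_partials g fx fy A"
  using has_cont_partials_continuous_on[OF f]
  by (intro has_cont_partialsI has_derivative_transform[OF _ eq has_cont_partials_has_derivative[OF f]])

lemma has_cont_partials_const: "has_cont_partials (\<lambda>_. c) (\<lambda>_. 0) (\<lambda>_. 0) A"
  by (rule has_cont_partialsI) (auto intro!: derivative_eq_intros)

lemma has_cont_partials_add: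
  assumes f: "has_cont_partials f fx fy A" and g: "has_cont_partials g gx gy A"
  shows "has_cont_partials (\<lambda>z. f z + g z) (\<lambda>z. fx z + gx z) (\<lambda>z. fy z + gy z) A"
  using has_cont_partials_continuous_on[OF f] has_cont_partials_continuous_on[OF g]
  by (intro has_cont_partialsI continuous_intros)
    (rule derivative_eq_intros f[THEN has_cont_partials_has_derivative] g[THEN has_cont_partials_has_derivative]
      | simp add: fun_eq_iff algebra_simps)+

lemma has_cont_partials_mult:
  assumes f: "has_cont_partials f fx fy A" and g: "has_cont_partials g gx gy A"
  shows "has_cont_partials (\<lambda>z. f z * g z) (\<lambda>z. fx z * g z + f z * gx z) (\<lambda>z. fy z * g z + f z * gy z) A"
  using has_cont_partials_continuous_on[OF f] has_cont_partials_continuous_on[OF g]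
  by (intro has_cont_partialsI continuous_intros)
    (rule derivative_eq_intros f[THEN has_cont_partials_has_derivative] g[THEN has_cont_partials_has_derivative]
      | simp add: fun_eq_iff algebra_simps)+

lemma has_cont_partials_compose:
  assumes f: "has_cont_partials f fx fy A"
    and \<phi>: "\<And>z. z \<in> A \<Longrightarrow> (\<phi> has_real_derivative \<phi>' (f z)) (at (f z))"
    and cont: "continuous_on A (\<lambda>z. \<phi>' (f z))"
  shows "has_cont_partials (\<lambda>z. \<phi> (f z)) (\<lambda>z. \<phi>' (f z) * fx z) (\<lambda>z. \<phi>' (f z) * fy z) A"
proof (rule has_cont_partialsI)
  fix z assume z: "z \<in> A"
  show "((\<lambda>z. \<phi> (f z)) has_derivative (\<lambda>h. fst h * (\<phi>' (f z) * fx z) + snd h * (\<phi>' (f z) * fy z)))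
      (at z within A)"
    using has_derivative_compose[OF has_cont_partials_has_derivative[OF f z]
        \<phi>[OF z, unfolded has_field_derivative_def]]
    by (simp add: algebra_simps)
qed (intro continuous_intros cont has_cont_partials_continuous_on[OF f])+

lemma has_cont_partials_sin:
  assumes f: "has_cont_partials f fx fy A"
  shows "has_cont_partials (\<lambda>z. sin (f z)) (\<lambda>z. cos (f z) * fx z) (\<lambda>z. cos (f z) * fy z) A"
  by (intro has_cont_partials_compose[OF f] DERIV_sin continuous_intros has_cont_partials_continuous_on[OF f])

lemma has_cont_partials_along_curve:
  assumes f: "has_cont_partials f fx fy A" and curve: "(\<lambda>s. (x s, y s)) ` I \<subseteq> A" "s \<in> I"
    and x: "(x has_real_derivative x') (at s within I)"
    and y: "(y has_real_derivative y') (at s within I)"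
  shows "((\<lambda>s. f (x s, y s)) has_real_derivative x' * fx (x s, y s) + y' * fy (x s, y s)) (at s within I)"
proof -
  have "((\<lambda>s. (x s, y s)) has_derivative (\<lambda>h. (x' * h, y' * h))) (at s within I)"
    using x y by (auto intro!: has_derivative_Pair simp: has_field_derivative_def)
  moreover have "(f has_derivative (\<lambda>h. fst h * fx (x s, y s) + snd h * fy (x s, y s)))
      (at (x s, y s) within (\<lambda>s. (x s, y s)) ` I)"
    using curve by (intro has_derivative_subset[OF has_cont_partials_has_derivative[OF f]]) auto
  ultimately show ?thesis
    unfolding has_field_derivative_def
    by (rule has_derivative_in_compose[THEN has_derivative_eq_rhs]) (auto simp: fun_eq_iff algebra_simps)
qed

lemma has_cont_partials_slices:
  assumes f: "has_cont_partials f fx fy U" and U: "open U" "(x, y) \<in> U"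
  shows has_cont_partials_slice_fst: "((\<lambda>x. f (x, y)) has_real_derivative fx (x, y)) (at x)"
    and has_cont_partials_slice_snd: "((\<lambda>y. f (x, y)) has_real_derivative fy (x, y)) (at y)"
proof -
  have "open ((\<lambda>x. (x, y)) -` U)" "open ((\<lambda>y. (x, y)) -` U)"
    by (intro open_vimage U continuous_intros)+
  then have "at x within (\<lambda>x. (x, y)) -` U = at x" "at y within (\<lambda>y. (x, y)) -` U = at y"
    using U by (auto intro!: at_within_open)
  then show "((\<lambda>x. f (x, y)) has_real_derivative fx (x, y)) (at x)"
    "((\<lambda>y. f (x, y)) has_real_derivative fy (x, y)) (at y)"
    using has_cont_partials_along_curve[OF f, of "\<lambda>x. x" "\<lambda>_. y" "(\<lambda>x. (x, y)) -` U" x 1 0]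
      has_cont_partials_along_curve[OF f, of "\<lambda>_. x" "\<lambda>y. y" "(\<lambda>y. (x, y)) -` U" y 0 1] U
    by (auto simp: image_subset_iff)
qed

lemma has_cont_partials_scale_snd:
  assumes f: "has_cont_partials f fx fy A" and scale: "\<And>x y. (x, y) \<in> A \<Longrightarrow> (x, c * y) \<in> A"
  shows "has_cont_partials (\<lambda>z. f (fst z, c * snd z)) (\<lambda>z. fx (fst z, c * snd z))
    (\<lambda>z. c * fy (fst z, c * snd z)) A"
proof (rule has_cont_partialsI)
  let ?scale = "\<lambda>z. (fst z, c * snd z) :: real \<times> real"
  have image: "?scale z \<in> A" if "z \<in> A" for z
    using scale[of "fst z" "snd z"] that by simp
  fix z assume z: "z \<in> A"
  have "(?scale has_derivative ?scale) (at z within A)"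
    by (intro derivative_intros)
  moreover have "(f has_derivative (\<lambda>h. fst h * fx (?scale z) + snd h * fy (?scale z)))
      (at (?scale z) within ?scale ` A)"
    using image z by (intro has_derivative_subset[OF has_cont_partials_has_derivative[OF f]]) auto
  ultimately show "((\<lambda>z. f (?scale z)) has_derivative
      (\<lambda>h. fst h * fx (?scale z) + snd h * (c * fy (?scale z)))) (at z within A)"
    by (rule has_derivative_in_compose[THEN has_derivative_eq_rhs]) (simp add: fun_eq_iff)
next
  have scaled: "continuous_on A (\<lambda>z. g (fst z, c * snd z))" if "continuous_on A g" for g :: "real \<times> real \<Rightarrow> real"
    by (rule continuous_on_compose2[OF that]) (use scale in \<open>auto intro!: continuous_intros\<close>)
  show "continuous_on A (\<lambda>z. fx (fst z, c * snd z))" "continuous_on A (\<lambda>z. c * fy (fst z, c * snd z))"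
    by (rule scaled continuous_on_mult_left has_cont_partials_continuous_on[OF f])+
qed

lemma continuous_on_Times_slice:
  assumes "continuous_on (A \<times> B) (\<lambda>(x, y). g x y)" "x \<in> A"
  shows "continuous_on B (g x)"
proof -
  have "continuous_on B (\<lambda>y. (x, y))" by (intro continuous_intros)
  from continuous_on_compose2[OF assms(1) this] assms(2) show ?thesis by (simp add: image_subset_iff)
qed

lemma has_cont_partials_integral:
  fixes f fx fy :: "real \<times> real \<Rightarrow> 'a::euclidean_space \<Rightarrow> real"
  assumes "convex A"
    and f: "\<And>\<theta>. \<theta> \<in> cbox a b \<Longrightarrow> has_cont_partials (\<lambda>z. f z \<theta>) (\<lambda>z. fx z \<theta>) (\<lambda>z. fy z \<theta>) A"
    and cont: "continuous_on (A \<times> cbox a b) (\<lambda>(z, \<theta>). f z \<theta>)"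
      "continuous_on (A \<times> cbox a b) (\<lambda>(z, \<theta>). fx z \<theta>)"
      "continuous_on (A \<times> cbox a b) (\<lambda>(z, \<theta>). fy z \<theta>)"
  shows "has_cont_partials (\<lambda>z. integral (cbox a b) (f z)) (\<lambda>z. integral (cbox a b) (fx z))
    (\<lambda>z. integral (cbox a b) (fy z)) A"
proof (rule has_cont_partialsI)
  fix z assume z: "z \<in> A"
  note integrable = integrable_continuous[OF continuous_on_Times_slice]
  define D :: "real \<times> real \<Rightarrow> 'a \<Rightarrow> (real \<times> real) \<Rightarrow>\<^sub>L real"
    where "D z \<theta> = fx z \<theta> *\<^sub>R fst_blinfun + fy z \<theta> *\<^sub>R snd_blinfun" for z \<theta>
  have D_apply: "blinfun_apply (D z \<theta>) = (\<lambda>h. fst h * fx z \<theta> + snd h * fy z \<theta>)" for z \<theta>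
    by (simp add: fun_eq_iff D_def blinfun.add_left blinfun.scaleR_left mult.commute)
  have cont_D: "continuous_on (A \<times> cbox a b) (\<lambda>(z, \<theta>). D z \<theta>)"
    using cont(2,3) unfolding D_def split_beta by (intro continuous_intros)
  have "((\<lambda>z. integral (cbox a b) (f z)) has_derivative blinfun_apply (integral (cbox a b) (D z)))
      (at z within A)"
    by (rule leibniz_rule[OF _ integrable[OF cont(1)] cont_D z \<open>convex A\<close>])
      (simp add: D_apply f[THEN has_cont_partials_has_derivative])
  moreover have "blinfun_apply (integral (cbox a b) (D z)) h
      = fst h * integral (cbox a b) (fx z) + snd h * integral (cbox a b) (fy z)" for h
    using integrable[OF cont(2) z] integrable[OF cont(3) z] integrable[OF cont_D z]
    by (simp add: blinfun_apply_integral D_apply integral_add integrable_on_mult_right)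
  ultimately show "((\<lambda>z. integral (cbox a b) (f z)) has_derivative
      (\<lambda>h. fst h * integral (cbox a b) (fx z) + snd h * integral (cbox a b) (fy z))) (at z within A)"
    by (rule has_derivative_eq_rhs[OF _ ext])
qed (intro integral_continuous_on_param cont)+

text \<open>Differentiating \<open>f (x, v) - f (x, b) = \<integral>\<^sub>b\<^sup>v f\<^sub>y (x, s) ds\<close> in \<open>x\<close>.\<close>

lemma integral_mixed_partial:
  assumes U: "open U" "{a..c} \<times> {b..v} \<subseteq> U" and x: "a < x" "x < c" and v: "b \<le> v"
    and f: "has_cont_partials f fx fy U" and fy: "has_cont_partials fy fyx fyy U"
  shows "integral {b..v} (\<lambda>s. fyx (x, s)) = fx (x, v) - fx (x, b)"
proof -
  have fundamental: "integral {b..v} (\<lambda>s. fy (x, s)) = f (x, v) - f (x, b)" if "x \<in> {a..c}" for x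
    using that U(2) v
    by (intro integral_unique fundamental_theorem_of_calculus)
      (auto simp: has_real_derivative_iff_has_vector_derivative[symmetric]
        intro!: DERIV_subset[OF has_cont_partials_slice_snd[OF f U(1)]])
  have "((\<lambda>x. integral {b..v} (\<lambda>s. fy (x, s))) has_real_derivative integral {b..v} (\<lambda>s. fyx (x, s)))
      (at x within {a..c})"
  proof (rule leibniz_rule_field_derivative[of "{a..c}" b v, unfolded cbox_interval])
    fix x assume "x \<in> {a..c}"
    then show "(\<lambda>s. fy (x, s)) integrable_on {b..v}"
      using U(2)
      by (intro integrable_continuous_real continuous_on_compose2[OF has_cont_partials_continuous_on(1)[OF fy]])
        (auto intro!: continuous_intros)
  next
    show "continuous_on ({a..c} \<times> {b..v}) (\<lambda>(x, s). fyx (x, s))"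
      using U(2) by (auto intro: continuous_on_subset[OF has_cont_partials_continuous_on(2)[OF fy]])
  qed (use x U(2) in \<open>auto intro!: DERIV_subset[OF has_cont_partials_slice_fst[OF fy U(1)]]\<close>)
  moreover have "((\<lambda>x. integral {b..v} (\<lambda>s. fy (x, s))) has_real_derivative fx (x, v) - fx (x, b))
      (at x within {a..c})"
  proof (rule has_field_derivative_transform_within[OF _ zero_less_one])
    show "((\<lambda>x. f (x, v) - f (x, b)) has_real_derivative fx (x, v) - fx (x, b)) (at x within {a..c})"
      using x U(2) v by (intro DERIV_diff DERIV_subset[OF has_cont_partials_slice_fst[OF f U(1)]]) auto
  qed (use x fundamental in auto)
  ultimately show ?thesis
    using x by (auto simp: at_within_Icc_at intro: DERIV_unique)
qed

lemma mixed_partials_eq: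
  assumes U: "open U" "z \<in> U"
    and f: "has_cont_partials f fx fy U"
    and fx: "has_cont_partials fx fxx fxy U" and fy: "has_cont_partials fy fyx fyy U"
  shows "fxy z = fyx z"
proof -
  obtain p q where "cbox p q \<subseteq> U" "z \<in> box p q"
    using open_contains_cbox[OF U] by metis
  then obtain a b c d x y where z: "z = (x, y)" "a < x" "x < c" "b < y" "y < d"
    and box: "{a..c} \<times> {b..d} \<subseteq> U"
    by (cases p, cases q, cases z) (auto simp: box_def Basis_prod_def cbox_Pair_eq)
  have difference: "integral {b..v} (\<lambda>s. fyx (x, s)) = fx (x, v) - fx (x, b)" if "v \<in> {b..d}" for v
    using that box by (intro integral_mixed_partial[OF U(1) _ z(2,3) _ f fy]) auto
  have "((\<lambda>v. integral {b..v} (\<lambda>s. fyx (x, s))) has_real_derivative fyx z) (at y within {b..d})"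
    unfolding z(1) using z box
    by (intro integral_has_real_derivative continuous_on_compose2[OF has_cont_partials_continuous_on(2)[OF fy]])
      (auto intro!: continuous_intros)
  moreover have "((\<lambda>v. integral {b..v} (\<lambda>s. fyx (x, s))) has_real_derivative fxy z) (at y within {b..d})"
  proof (rule has_field_derivative_transform_within[OF _ zero_less_one])
    show "((\<lambda>v. fx (x, v) - fx (x, b)) has_real_derivative fxy z) (at y within {b..d})"
      using z box
      by (auto intro!: derivative_eq_intros DERIV_subset[OF has_cont_partials_slice_snd[OF fx U(1)]])
  qed (use z difference in auto)
  ultimately show ?thesis
    using z by (auto simp: at_within_Icc_at intro: DERIV_unique)
qed

text \<open>Hadamard's lemma, with \<open>g (x, y) = \<integral>\<^sub>0\<^sup>1 f\<^sub>y (x, \<theta> y) d\<theta>\<close>.\<close>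

lemma hadamard_division:
  assumes convex: "convex A"
    and segment: "\<And>x y \<theta>. (x, y) \<in> A \<Longrightarrow> 0 \<le> \<theta> \<Longrightarrow> \<theta> \<le> 1 \<Longrightarrow> (x, \<theta> * y) \<in> A"
    and f: "has_cont_partials f fx fy A" and fy: "has_cont_partials fy fyx fyy A"
    and axis: "\<And>x y. (x, y) \<in> A \<Longrightarrow> f (x, 0) = 0"
  obtains g gx gy where "has_cont_partials g gx gy A" "\<And>x y. (x, y) \<in> A \<Longrightarrow> y * g (x, y) = f (x, y)"
proof -
  let ?scale = "\<lambda>z \<theta>. (fst z, \<theta> * snd z) :: real \<times> real"
  have cont: "continuous_on (A \<times> cbox 0 1) (\<lambda>(z, \<theta>). g (?scale z \<theta>))"
    if "continuous_on A g" for g :: "real \<times> real \<Rightarrow> real"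
    unfolding split_beta
    by (rule continuous_on_compose2[OF that]) (use segment in \<open>auto intro!: continuous_intros\<close>)
  define g where "g z = integral (cbox 0 1) (\<lambda>\<theta>. fy (?scale z \<theta>))" for z
  have "has_cont_partials g (\<lambda>z. integral (cbox 0 1) (\<lambda>\<theta>. fyx (?scale z \<theta>)))
      (\<lambda>z. integral (cbox 0 1) (\<lambda>\<theta>. \<theta> * fyy (?scale z \<theta>))) A"
    unfolding g_def
  proof (rule has_cont_partials_integral[OF convex])
    show "continuous_on (A \<times> cbox 0 1) (\<lambda>(z, \<theta>). \<theta> * fyy (?scale z \<theta>))"
      using cont[OF has_cont_partials_continuous_on(3)[OF fy]]
      unfolding split_beta by (intro continuous_intros)
  qed (use segment in \<open>auto intro!: has_cont_partials_scale_snd[OF fy] cont[simplified]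
        has_cont_partials_continuous_on[OF fy]\<close>)
  moreover have "y * g (x, y) = f (x, y)" if z: "(x, y) \<in> A" for x y
  proof -
    have "((\<lambda>\<theta>. y * fy (x, \<theta> * y)) has_integral f (x, 1 * y) - f (x, 0 * y)) {0..1}"
    proof (rule fundamental_theorem_of_calculus)
      fix \<theta> :: real assume \<theta>: "\<theta> \<in> {0..1}"
      have "((\<lambda>\<theta>. f (x, \<theta> * y)) has_real_derivative 0 * fx (x, \<theta> * y) + y * fy (x, \<theta> * y)) (at \<theta> within {0..1})"
        using segment[OF z] \<theta> by (intro has_cont_partials_along_curve[OF f]) (auto intro!: derivative_eq_intros)
      then show "((\<lambda>\<theta>. f (x, \<theta> * y)) has_vector_derivative y * fy (x, \<theta> * y)) (at \<theta> within {0..1})"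
        by (simp add: has_real_derivative_iff_has_vector_derivative)
    qed simp
    then show ?thesis using axis[OF z] by (auto simp: g_def dest!: integral_unique)
  qed
  ultimately show thesis using that by blast
qed

lemma smooth_on_set_cont_partials:
  assumes "smooth_on_set u A"
  obtains U ut ur utt utr urr where "open U" "A \<subseteq> U"
    "has_cont_partials (\<lambda>(t, r). u t r) ut ur U"
    "has_cont_partials ut utt utr U" "has_cont_partials ur utr urr U"
proof -
  obtain U where U: "open U" "A \<subseteq> U" and "Ck_on (Suc (Suc 0)) (\<lambda>(t, r). u t r) U"
    using assms unfolding smooth_on_set_def smooth_open_def by blast
  then obtain ut ur utt utr urt urr where
    u: "\<And>z. z \<in> U \<Longrightarrow> ((\<lambda>(t, r). u t r) has_derivative (\<lambda>(a, b). a * ut z + b * ur z)) (at z)"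
    and ut: "\<And>z. z \<in> U \<Longrightarrow> (ut has_derivative (\<lambda>(a, b). a * utt z + b * utr z)) (at z)"
    and ur: "\<And>z. z \<in> U \<Longrightarrow> (ur has_derivative (\<lambda>(a, b). a * urt z + b * urr z)) (at z)"
    and cont: "continuous_on U utt" "continuous_on U utr" "continuous_on U urt" "continuous_on U urr"
    unfolding Ck_on.simps by blast
  have partials: "has_cont_partials f fx fy U"
    if "\<And>z. z \<in> U \<Longrightarrow> (f has_derivative (\<lambda>(a, b). a * fx z + b * fy z)) (at z)"
      "continuous_on U fx" "continuous_on U fy" for f fx fy
    using that by (simp add: has_cont_partials_def has_derivative_at_withinI case_prod_beta')
  have ut_partials: "has_cont_partials ut utt utr U" and ur_partials: "has_cont_partials ur urt urr U"
    using partials[OF ut cont(1,2)] partials[OF ur cont(3,4)] by simp_all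
  have u_partials: "has_cont_partials (\<lambda>(t, r). u t r) ut ur U"
    using ut_partials ur_partials by (intro partials u) (auto dest: has_cont_partials_continuous_on)
  have "utr z = urt z" if "z \<in> U" for z
    by (rule mixed_partials_eq[OF U(1) that u_partials ut_partials ur_partials])
  then have "has_cont_partials ur utr urr U"
    using ur_partials by (simp add: has_cont_partials_def cong: continuous_on_cong)
  then show thesis using that U u_partials ut_partials by blast
qed

lemma dt_dr_eq_partials:
  assumes "has_cont_partials (\<lambda>(t, r). u t r) ut ur U" "open U" "(t, r) \<in> U"
  shows "dt u t r = ut (t, r)" "dr u t r = ur (t, r)"
  using has_cont_partials_slices[OF assms] by (simp_all add: dt_def dr_def DERIV_imp_deriv)

section \<open>Balance laws on the cone\<close>

lemma convex_Omega: "convex (Omega T)"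
proof -
  have "Omega T = fst -` {0<..T} \<inter> snd -` {0..} \<inter> (\<lambda>z. fst z - snd z) -` {0..}"
    by (auto simp: Omega_def)
  then show ?thesis
    by (auto intro!: convex_Int convex_linear_vimage bounded_linear.linear bounded_linear_intros)
qed

lemma has_cont_partials_Omega_unique:
  assumes f: "has_cont_partials f ft fr (Omega T)" and g: "has_cont_partials g gt gr (Omega T)"
    and eq: "\<And>z. z \<in> Omega T \<Longrightarrow> f z = g z" and z: "(t, r) \<in> Omega T" "r < t"
  shows "ft (t, r) = gt (t, r)" "fr (t, r) = gr (t, r)"
proof -
  have "(\<lambda>h. fst h * ft (t, r) + snd h * fr (t, r)) = (\<lambda>h. fst h * gt (t, r) + snd h * gr (t, r))"
  proof (rule frechet_derivative_unique_within)
    show "(f has_derivative (\<lambda>h. fst h * ft (t, r) + snd h * fr (t, r))) (at (t, r) within Omega T)"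
      by (rule has_cont_partials_has_derivative[OF f z(1)])
    show "(f has_derivative (\<lambda>h. fst h * gt (t, r) + snd h * gr (t, r))) (at (t, r) within Omega T)"
      by (rule has_cont_partials_has_derivative[OF has_cont_partials_cong[OF g eq] z(1)])
    fix i :: "real \<times> real" and e :: real assume i: "i \<in> Basis" and e: "e > 0"
    define d where "d = min e (t - r) / 2"
    have d: "0 < d" "d < e" "d < t - r" using e z by (auto simp: d_def)
    have "(t, r) + (- d) *\<^sub>R (1, 0) \<in> Omega T" "(t, r) + d *\<^sub>R (0, 1) \<in> Omega T"
      using z d by (auto simp: Omega_def)
    moreover have "i = (1, 0) \<or> i = (0, 1)" using i by (auto simp: Basis_prod_def)
    moreover have "0 < \<bar>- d\<bar>" "\<bar>- d\<bar> < e" "0 < \<bar>d\<bar>" "\<bar>d\<bar> < e" using d by auto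
    ultimately show "\<exists>d. 0 < \<bar>d\<bar> \<and> \<bar>d\<bar> < e \<and> (t, r) + d *\<^sub>R i \<in> Omega T" by blast
  qed
  from fun_cong[OF this, of "(1, 0)"] fun_cong[OF this, of "(0, 1)"]
  show "ft (t, r) = gt (t, r)" "fr (t, r) = gr (t, r)" by simp_all
qed

lemma has_cont_partials_Omega_radial:
  assumes f: "has_cont_partials f ft fr (Omega T)" and r: "0 < r" "r < t" "t \<le> T"
  shows "((\<lambda>r. f (t, r)) has_real_derivative fr (t, r)) (at r)"
proof -
  have "((\<lambda>r. f (t, r)) has_real_derivative 0 * ft (t, r) + 1 * fr (t, r)) (at r within {0..t})"
    using r by (intro has_cont_partials_along_curve[OF f]) (auto simp: Omega_def)
  then show ?thesis using r by (simp add: at_within_Icc_at)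
qed

definition slice_integral :: "(real \<times> real \<Rightarrow> real) \<Rightarrow> real \<Rightarrow> real" where
  "slice_integral f t = integral {0..t} (\<lambda>r. f (t, r))"

lemma continuous_on_slice:
  assumes "continuous_on (Omega T) f" "0 < t" "t \<le> T"
  shows "continuous_on {0..t} (\<lambda>r. f (t, r))"
  by (rule continuous_on_compose2[OF assms(1)]) (use assms in \<open>auto simp: Omega_def intro!: continuous_intros\<close>)

lemma slice_has_integral:
  assumes "continuous_on (Omega T) f" "0 < t" "t \<le> T"
  shows "((\<lambda>r. f (t, r)) has_integral slice_integral f t) {0..t}"
  unfolding slice_integral_def
  by (intro integrable_integral integrable_continuous_real continuous_on_slice[OF assms])

lemma slice_integral_le:
  assumes "continuous_on (Omega T) f" "0 < t" "t \<le> T"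
    and "(g has_integral I) {0..t}" "\<And>r. 0 \<le> r \<Longrightarrow> r \<le> t \<Longrightarrow> f (t, r) \<le> g r"
  shows "slice_integral f t \<le> I"
  using slice_has_integral[OF assms(1-3)] assms(4,5) by (rule has_integral_le) auto

lemma slice_integral_scaled:
  assumes "continuous_on (Omega T) f" "0 < t" "t \<le> T"
  shows "((\<lambda>y. t * f (t, t * y)) has_integral slice_integral f t) {0..1}"
  using has_integral_substitution[of 0 1 "\<lambda>y. t * y" 0 t "\<lambda>r. f (t, r)" "\<lambda>_. t"]
    continuous_on_slice[OF assms] assms(2)
  by (auto intro!: derivative_eq_intros simp: mult_left_le slice_integral_def)

lemma has_integral_scaled_radial_derivative:
  assumes P: "has_cont_partials P Pt Pr (Omega T)" and t: "0 < t" "t \<le> T"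
  shows "((\<lambda>y. P (t, t * y) + t * y * Pr (t, t * y)) has_integral P (t, t)) {0..1}"
proof -
  have "((\<lambda>y. P (t, t * y) + t * y * Pr (t, t * y)) has_integral 1 * P (t, t * 1) - 0 * P (t, t * 0)) {0..1}"
  proof (rule fundamental_theorem_of_calculus)
    fix y :: real assume y: "y \<in> {0..1}"
    have "((\<lambda>y. P (t, t * y)) has_real_derivative 0 * Pt (t, t * y) + t * Pr (t, t * y)) (at y within {0..1})"
      using t y by (intro has_cont_partials_along_curve[OF P])
        (auto simp: Omega_def mult_left_le intro!: derivative_eq_intros)
    then show "((\<lambda>y. y * P (t, t * y)) has_vector_derivative P (t, t * y) + t * y * Pr (t, t * y))
        (at y within {0..1})"
      unfolding has_real_derivative_iff_has_vector_derivative[symmetric]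
      by (auto intro!: derivative_eq_intros)
  qed simp
  then show ?thesis by simp
qed

text \<open>The substitution \<open>r = t y\<close> fixes the domain of integration without leaving the cone.\<close>

lemma slice_integral_has_derivative:
  assumes P: "has_cont_partials P Pt Pr (Omega T)" and t: "0 < t" "t \<le> T"
  shows "(slice_integral P has_real_derivative P (t, t) + slice_integral Pt t) (at t within {0<..T})"
proof -
  note cont = has_cont_partials_continuous_on[OF P]
  have scaled: "continuous_on ({0<..T} \<times> {0..1}) (\<lambda>(s, y). f (s, s * y))"
    if "continuous_on (Omega T) f" for f :: "real \<times> real \<Rightarrow> real"
    unfolding split_beta
    by (rule continuous_on_compose2[OF that])
      (auto simp: Omega_def mult_left_le intro!: continuous_intros)
  define D where "D s y = P (s, s * y) + s * (Pt (s, s * y) + y * Pr (s, s * y))" for s y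
  have "((\<lambda>s. integral {0..1} (\<lambda>y. s * P (s, s * y))) has_real_derivative integral {0..1} (D t))
      (at t within {0<..T})"
  proof (rule leibniz_rule_field_derivative[where a = "0::real" and b = 1, unfolded cbox_interval])
    fix s assume s: "s \<in> {0<..T}"
    show "(\<lambda>y. s * P (s, s * y)) integrable_on {0..1}"
      using s by (intro has_integral_integrable[OF slice_integral_scaled[OF cont(1)]]) auto
    fix y :: real assume y: "y \<in> {0..1}"
    have "((\<lambda>s. P (s, s * y)) has_real_derivative 1 * Pt (s, s * y) + y * Pr (s, s * y)) (at s within {0<..T})"
      using s y by (intro has_cont_partials_along_curve[OF P])
        (auto simp: Omega_def mult_left_le intro!: derivative_eq_intros)
    then show "((\<lambda>s. s * P (s, s * y)) has_real_derivative D s y) (at s within {0<..T})"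
      unfolding D_def by (auto intro!: derivative_eq_intros)
  next
    show "continuous_on ({0<..T} \<times> {0..1}) (\<lambda>(s, y). D s y)"
      using cont[THEN scaled] unfolding D_def split_beta by (auto intro!: continuous_intros)
  qed (use t in auto)
  then have "(slice_integral P has_real_derivative integral {0..1} (D t)) (at t within {0<..T})"
    by (rule has_field_derivative_transform_within[OF _ zero_less_one])
      (use t slice_integral_scaled[OF cont(1), THEN integral_unique] in auto)
  moreover have "(D t has_integral P (t, t) + slice_integral Pt t) {0..1}"
    using has_integral_add[OF has_integral_scaled_radial_derivative[OF P t] slice_integral_scaled[OF cont(2) t]]
    by (simp add: D_def[abs_def] algebra_simps)
  ultimately show ?thesis by (simp add: integral_unique)
qed

text \<open>\<open>balance_law T P Q H\<close> says that \<open>\<partial>\<^sub>t P = \<partial>\<^sub>r Q + H\<close> in the cone.\<close>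

definition balance_law ::
    "real \<Rightarrow> (real \<times> real \<Rightarrow> real) \<Rightarrow> (real \<times> real \<Rightarrow> real) \<Rightarrow> (real \<times> real \<Rightarrow> real) \<Rightarrow> bool" where
  "balance_law T P Q H \<longleftrightarrow> continuous_on (Omega T) Q \<and> continuous_on (Omega T) H \<and>
     (\<exists>Pt Pr. has_cont_partials P Pt Pr (Omega T) \<and>
       (\<forall>t r. t \<le> T \<longrightarrow> 0 < r \<longrightarrow> r < t \<longrightarrow>
         ((\<lambda>r. Q (t, r)) has_real_derivative Pt (t, r) - H (t, r)) (at r)))"

lemma balance_lawI:
  assumes "continuous_on (Omega T) Q" "continuous_on (Omega T) H" "has_cont_partials P Pt Pr (Omega T)"
    and "\<And>t r. t \<le> T \<Longrightarrow> 0 < r \<Longrightarrow> r < t \<Longrightarrow>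
      ((\<lambda>r. Q (t, r)) has_real_derivative Pt (t, r) - H (t, r)) (at r)"
  shows "balance_law T P Q H"
  using assms unfolding balance_law_def by blast

lemma balance_lawE:
  assumes "balance_law T P Q H"
  obtains Pt Pr where "has_cont_partials P Pt Pr (Omega T)"
    "continuous_on (Omega T) Q" "continuous_on (Omega T) H"
    "\<And>t r. t \<le> T \<Longrightarrow> 0 < r \<Longrightarrow> r < t \<Longrightarrow>
      ((\<lambda>r. Q (t, r)) has_real_derivative Pt (t, r) - H (t, r)) (at r)"
  using assms unfolding balance_law_def by blast

lemma balance_law_add:
  assumes law: "balance_law T P Q H" and law': "balance_law T P' Q' H'"
  shows "balance_law T (\<lambda>z. P z + P' z) (\<lambda>z. Q z + Q' z) (\<lambda>z. H z + H' z)"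
proof -
  obtain Pt Pr where P: "has_cont_partials P Pt Pr (Omega T)"
    and cont: "continuous_on (Omega T) Q" "continuous_on (Omega T) H"
    and Q: "\<And>t r. t \<le> T \<Longrightarrow> 0 < r \<Longrightarrow> r < t \<Longrightarrow>
      ((\<lambda>r. Q (t, r)) has_real_derivative Pt (t, r) - H (t, r)) (at r)"
    using balance_lawE[OF law] by blast
  obtain Pt' Pr' where P': "has_cont_partials P' Pt' Pr' (Omega T)"
    and cont': "continuous_on (Omega T) Q'" "continuous_on (Omega T) H'"
    and Q': "\<And>t r. t \<le> T \<Longrightarrow> 0 < r \<Longrightarrow> r < t \<Longrightarrow>
      ((\<lambda>r. Q' (t, r)) has_real_derivative Pt' (t, r) - H' (t, r)) (at r)"
    using balance_lawE[OF law'] by blast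
  show ?thesis
    by (rule balance_lawI[OF _ _ has_cont_partials_add[OF P P']])
      (auto intro!: continuous_intros cont cont' derivative_eq_intros Q Q')
qed

lemma balance_law_mult:
  assumes law: "balance_law T P Q H" and w: "has_cont_partials w wt wr (Omega T)"
  shows "balance_law T (\<lambda>z. w z * P z) (\<lambda>z. w z * Q z) (\<lambda>z. wt z * P z - wr z * Q z + w z * H z)"
proof -
  obtain Pt Pr where P: "has_cont_partials P Pt Pr (Omega T)"
    and cont: "continuous_on (Omega T) Q" "continuous_on (Omega T) H"
    and Q: "\<And>t r. t \<le> T \<Longrightarrow> 0 < r \<Longrightarrow> r < t \<Longrightarrow>
      ((\<lambda>r. Q (t, r)) has_real_derivative Pt (t, r) - H (t, r)) (at r)"
    using balance_lawE[OF law] by blast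
  show ?thesis
    by (rule balance_lawI[OF _ _ has_cont_partials_mult[OF w P]])
      (auto intro!: continuous_intros cont has_cont_partials_continuous_on[OF P]
        has_cont_partials_continuous_on[OF w] derivative_eq_intros Q has_cont_partials_Omega_radial[OF w]
        simp: algebra_simps)
qed

lemma balance_law_has_derivative:
  assumes law: "balance_law T P Q H" and t: "0 < t" "t \<le> T"
  shows "(slice_integral P has_real_derivative P (t, t) + (Q (t, t) - Q (t, 0)) + slice_integral H t)
    (at t within {0<..T})"
proof -
  obtain Pt Pr where P: "has_cont_partials P Pt Pr (Omega T)"
    and cont: "continuous_on (Omega T) Q" "continuous_on (Omega T) H"
    and Q: "\<And>t r. t \<le> T \<Longrightarrow> 0 < r \<Longrightarrow> r < t \<Longrightarrow>
      ((\<lambda>r. Q (t, r)) has_real_derivative Pt (t, r) - H (t, r)) (at r)"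
    using balance_lawE[OF law] by blast
  have "((\<lambda>r. Pt (t, r) - H (t, r)) has_integral Q (t, t) - Q (t, 0)) {0..t}"
    using t by (intro fundamental_theorem_of_calculus_interior continuous_on_slice[OF cont(1)])
      (auto intro!: Q simp: has_real_derivative_iff_has_vector_derivative[symmetric])
  from has_integral_add[OF this slice_has_integral[OF cont(2) t]]
  have "slice_integral Pt t = Q (t, t) - Q (t, 0) + slice_integral H t"
    by (simp add: slice_integral_def integral_unique)
  then show ?thesis
    using slice_integral_has_derivative[OF P t] by (simp add: add.assoc)
qed

section \<open>Elementary inequalities\<close>

lemma has_integral_Cauchy_Schwarz:
  fixes f g :: "'a::euclidean_space \<Rightarrow> real"
  assumes ff: "((\<lambda>x. (f x)\<^sup>2) has_integral A) S" and gg: "((\<lambda>x. (g x)\<^sup>2) has_integral B) S"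
    and fg: "((\<lambda>x. f x * g x) has_integral C) S"
  shows "C\<^sup>2 \<le> A * B"
proof -
  have quadratic: "0 \<le> A * c\<^sup>2 - 2 * C * c + B" for c
  proof -
    have "((\<lambda>x. (f x)\<^sup>2 * c\<^sup>2 - 2 * (f x * g x) * c + (g x)\<^sup>2) has_integral A * c\<^sup>2 - 2 * C * c + B) S"
      by (intro has_integral_add has_integral_diff has_integral_mult_left has_integral_mult_right assms)
    moreover have "0 \<le> (f x)\<^sup>2 * c\<^sup>2 - 2 * (f x * g x) * c + (g x)\<^sup>2" for x
      using zero_le_power2[of "f x * c - g x"] by (simp add: power2_diff power_mult_distrib algebra_simps)
    ultimately show ?thesis by (rule has_integral_nonneg)
  qed
  show ?thesis
  proof (cases "A = 0")
    case True
    then have "C = 0"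
      using quadratic[of "(B + 1) / (2 * C)"] by (cases "C = 0") (auto simp: field_simps)
    then show ?thesis using True by simp
  next
    case False
    moreover have "0 \<le> A" using has_integral_nonneg[OF ff] by simp
    ultimately show ?thesis
      using quadratic[of "C / A"] by (simp add: field_simps power2_eq_square)
  qed
qed

lemma neg_ln_le:
  fixes x :: real
  assumes "0 < x" "x \<le> 1"
  shows "- 2 * ln x \<le> 1 / x - x"
proof -
  have "2 * ln x + 1 / x - x \<ge> 2 * ln 1 + 1 / 1 - (1::real)"
  proof (rule DERIV_nonpos_imp_nonincreasing[OF assms(2)])
    fix y assume y: "x \<le> y" "y \<le> 1"
    have "((\<lambda>y. 2 * ln y + 1 / y - y) has_real_derivative - (1 / y - 1)\<^sup>2) (at y)"
      using y assms by (auto intro!: derivative_eq_intros simp: field_simps power2_eq_square)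
    then show "\<exists>d. ((\<lambda>y. 2 * ln y + 1 / y - y) has_real_derivative d) (at y) \<and> d \<le> 0"
      by (intro exI[of _ "- (1 / y - 1)\<^sup>2"]) auto
  qed
  then show ?thesis by simp
qed

lemma neg_ln_one_minus_bounds:
  fixes y :: real
  assumes y: "0 \<le> y" "y < 1"
  shows "y \<le> - ln (1 - y)" "(- ln (1 - y))\<^sup>2 * (1 - y) \<le> y\<^sup>2"
proof -
  show lower: "y \<le> - ln (1 - y)" using ln_le_minus_one[of "1 - y"] y by simp
  define x where "x = sqrt (1 - y)"
  have x: "0 < x" "x \<le> 1" "x\<^sup>2 = 1 - y" using y by (auto simp: x_def)
  have "- ln (1 - y) = - 2 * ln x" using y by (simp add: x_def ln_sqrt)
  then have "- ln (1 - y) * x \<le> (1 / x - x) * x"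
    using neg_ln_le[OF x(1,2)] x by (intro mult_right_mono) auto
  also have "\<dots> = y" using x by (simp add: left_diff_distrib power2_eq_square)
  finally have "(- ln (1 - y) * x)\<^sup>2 \<le> y\<^sup>2"
    using lower x y by (intro power_mono mult_nonneg_nonneg) auto
  then show "(- ln (1 - y))\<^sup>2 * (1 - y) \<le> y\<^sup>2" by (simp only: power_mult_distrib x)
qed

text \<open>With \<open>z = 1 / (1 - y)\<close> and \<open>l = L / y\<close>, the discriminant condition for this quadratic form is
  \<open>z - 1 + l - l\<^sup>2 \<ge> 0\<close>.\<close>

lemma log_multiplier_coercive:
  fixes y L a b :: real
  assumes y: "0 \<le> y" "y < 1" and L: "y \<le> L" "L\<^sup>2 * (1 - y) \<le> y\<^sup>2"
  shows "y * a\<^sup>2 \<le> y / (1 - y) * (a\<^sup>2 + b\<^sup>2 + 2 * y * a * b) + L * (a\<^sup>2 - b\<^sup>2)"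
proof (cases "y = 0")
  case True
  then show ?thesis using L by simp
next
  case False
  with y have y: "0 < y" "y < 1" by auto
  define z l where "z = 1 / (1 - y)" and "l = L / y"
  have z: "z \<ge> 1" "y * z = z - 1" using y by (auto simp: z_def field_simps)
  have l: "1 \<le> l" "l\<^sup>2 \<le> z" using L y by (auto simp: l_def z_def field_simps)
  define P where "P = z + l - 1"
  have P: "P > 0" using z l by (simp add: P_def)
  have "P * (P * a\<^sup>2 + (z - l) * b\<^sup>2 + 2 * (z - 1) * a * b)
     = (P * a + (z - 1) * b)\<^sup>2 + (z - l\<^sup>2 + (l - 1)) * b\<^sup>2"
    by (simp add: P_def power2_eq_square algebra_simps)
  also have "\<dots> \<ge> 0" using l by (intro add_nonneg_nonneg mult_nonneg_nonneg) auto
  finally have "0 \<le> P * a\<^sup>2 + (z - l) * b\<^sup>2 + 2 * (z - 1) * a * b"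
    using P by (simp add: zero_le_mult_iff)
  then have "0 \<le> y * (P * a\<^sup>2 + (z - l) * b\<^sup>2 + 2 * (z - 1) * a * b)" using y by simp
  also have "\<dots> = y * z * (a\<^sup>2 + b\<^sup>2 + 2 * y * a * b) + L * (a\<^sup>2 - b\<^sup>2) - y * a\<^sup>2"
  proof -
    have "L = y * l" using y by (simp add: l_def)
    then show ?thesis unfolding P_def using z(2) by algebra
  qed
  finally show ?thesis by (simp add: z_def)
qed

lemma log_source_pointwise_le:
  fixes r \<tau> q k a b :: real
  assumes r: "0 \<le> r" "r < \<tau>" and q: "0 \<le> q"
  defines "L \<equiv> ln \<tau> - ln (\<tau> - r)"
  shows "(1 / \<tau> - 1 / (\<tau> - r)) * (r * (1 + q) * a * b) - 1 / (\<tau> - r) * (r * ((1 + q) * (a\<^sup>2 + b\<^sup>2) - k\<^sup>2) / 2)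
      + L * (- ((1 - q) * (a\<^sup>2 - b\<^sup>2) + k\<^sup>2) / 2)
    \<le> (r * k\<^sup>2 / (\<tau> - r) - r * (a\<^sup>2 + q * b\<^sup>2) / \<tau>) / 2" (is "?source \<le> _")
proof -
  define y g where "y = r / \<tau>" and "g = r / (\<tau> - r)"
  have y: "0 \<le> y" "y < 1" and g: "g = y / (1 - y)" using r by (auto simp: y_def g_def field_simps)
  have "L = - ln (1 - y)"
    using r ln_div[of "\<tau> - r" \<tau>] by (simp add: L_def y_def diff_divide_distrib)
  with neg_ln_one_minus_bounds[OF y] have L: "y \<le> L" "L\<^sup>2 * (1 - y) \<le> y\<^sup>2" by simp_all
  define form where "form a b = g * (a\<^sup>2 + b\<^sup>2 + 2 * y * a * b) + L * (a\<^sup>2 - b\<^sup>2)" for a b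
  have coercive: "y * a\<^sup>2 \<le> form a b" for a b
    unfolding form_def g by (rule log_multiplier_coercive[OF y L])
  have cross: "(1 / \<tau> - 1 / (\<tau> - r)) * (r * (1 + q) * a * b) = - (y * g * (1 + q) * a * b)"
    using r by (simp add: y_def g_def field_simps)
  have flux: "1 / (\<tau> - r) * (r * ((1 + q) * (a\<^sup>2 + b\<^sup>2) - k\<^sup>2) / 2) = g * ((1 + q) * (a\<^sup>2 + b\<^sup>2) - k\<^sup>2) / 2"
    by (simp add: g_def)
  have "?source = - (y * g * (1 + q) * a * b) - g * ((1 + q) * (a\<^sup>2 + b\<^sup>2) - k\<^sup>2) / 2
      + L * (- ((1 - q) * (a\<^sup>2 - b\<^sup>2) + k\<^sup>2) / 2)"
    unfolding cross flux ..
  also have "\<dots> = (g * k\<^sup>2 - L * k\<^sup>2 - form a b - q * form b a) / 2"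
    by (simp add: form_def field_simps)
  also have "\<dots> \<le> (g * k\<^sup>2 - 0 - y * a\<^sup>2 - q * (y * b\<^sup>2)) / 2"
    using L y q by (intro divide_right_mono diff_mono coercive mult_left_mono order_refl) auto
  also have "\<dots> = (r * k\<^sup>2 / (\<tau> - r) - r * (a\<^sup>2 + q * b\<^sup>2) / \<tau>) / 2"
    by (simp add: y_def g_def add_divide_distrib distrib_left mult_ac)
  finally show ?thesis .
qed

lemma virial_source_pointwise_le:
  fixes q k c a b :: real
  assumes q: "0 \<le> q" and c: "1 / 2 \<le> c" "c \<le> 1"
  shows "c * (3 / (1 + q) - 1 - 2 * q) * (a\<^sup>2 - b\<^sup>2) - c * (2 - q) / (1 + q) * k\<^sup>2 - 6 * q / (1 + q) * k * b
    \<le> 2 * a\<^sup>2 + 8 * (q * b\<^sup>2) - b\<^sup>2 - q * a\<^sup>2 + 5 * k\<^sup>2"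
proof -
  define \<kappa> where "\<kappa> = 3 / (1 + q) - 1 - 2 * q"
  have \<kappa>: "2 - 5 * q \<le> \<kappa>" "\<kappa> \<le> 2 - 2 * q"
    using q by (auto simp: \<kappa>_def field_simps)
  have "\<kappa> * (a\<^sup>2 - b\<^sup>2) \<le> (2 * a\<^sup>2 + 5 * (q * b\<^sup>2)) - 2 * (b\<^sup>2 + q * a\<^sup>2)"
    using mult_right_mono[OF \<kappa>(1), of "b\<^sup>2"] mult_right_mono[OF \<kappa>(2), of "a\<^sup>2"]
    by (simp add: algebra_simps)
  then have "c * (\<kappa> * (a\<^sup>2 - b\<^sup>2)) \<le> c * (2 * a\<^sup>2 + 5 * (q * b\<^sup>2)) - c * (2 * (b\<^sup>2 + q * a\<^sup>2))"
    using c unfolding right_diff_distrib[symmetric] by (intro mult_left_mono) auto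
  also have "\<dots> \<le> 1 * (2 * a\<^sup>2 + 5 * (q * b\<^sup>2)) - 1 / 2 * (2 * (b\<^sup>2 + q * a\<^sup>2))"
    using q c by (intro diff_mono mult_right_mono) auto
  finally have kinetic: "c * \<kappa> * (a\<^sup>2 - b\<^sup>2) \<le> 2 * a\<^sup>2 + 5 * (q * b\<^sup>2) - b\<^sup>2 - q * a\<^sup>2"
    by (simp add: mult.assoc add_divide_distrib)
  have "\<bar>(2 - q) / (1 + q)\<bar> \<le> 2" using q by (auto simp: abs_le_iff field_simps)
  then have "\<bar>c * ((2 - q) / (1 + q))\<bar> \<le> 1 * 2"
    unfolding abs_mult using c by (intro mult_mono) auto
  then have "- (c * (2 - q) / (1 + q)) \<le> 2" unfolding times_divide_eq_right abs_le_iff by simp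
  from mult_right_mono[OF this, of "k\<^sup>2"]
  have potential: "- (c * (2 - q) / (1 + q) * k\<^sup>2) \<le> 2 * k\<^sup>2" by simp
  define w where "w = q / (1 + q)"
  have w: "0 \<le> w" "w \<le> 1" "w \<le> q" using q by (auto simp: w_def field_simps)
  have "0 \<le> w * (k + b)\<^sup>2" using w by simp
  then have "- (2 * w * k * b) \<le> w * b\<^sup>2 + w * k\<^sup>2" by (simp add: power2_eq_square algebra_simps)
  also have "\<dots> \<le> q * b\<^sup>2 + 1 * k\<^sup>2" using w by (intro add_mono mult_right_mono) auto
  finally have "- (6 * w * k * b) \<le> 3 * (q * b\<^sup>2 + k\<^sup>2)" by simp
  then have cross: "- (6 * q / (1 + q) * k * b) \<le> 3 * (q * b\<^sup>2 + k\<^sup>2)" by (simp add: w_def)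
  show ?thesis
    using add_mono[OF add_mono[OF kinetic potential] cross] by (simp add: \<kappa>_def)
qed

lemma virial_dens_pointwise_le:
  fixes q k s a \<tau> Y :: real
  assumes \<tau>: "0 < \<tau>" "\<bar>s\<bar> \<le> \<tau> * \<bar>k\<bar>" and q: "0 \<le> q" "q * s\<^sup>2 \<le> 2 * Y"
  shows "\<bar>s * (2 - q) * a\<bar> / \<tau> \<le> a\<^sup>2 + k\<^sup>2 + q * a\<^sup>2 / 2 + Y / \<tau>\<^sup>2"
proof -
  define p where "p = \<bar>s\<bar> / \<tau>"
  have p: "0 \<le> p" "p \<le> \<bar>k\<bar>" using \<tau> by (auto simp: p_def pos_divide_le_eq mult.commute)
  have "2 * (p * \<bar>a\<bar>) \<le> 2 * (\<bar>k\<bar> * \<bar>a\<bar>)" using p by (intro mult_left_mono mult_right_mono) auto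
  also have "\<dots> \<le> a\<^sup>2 + k\<^sup>2" using sum_squares_bound[of "\<bar>k\<bar>" "\<bar>a\<bar>"] by simp
  finally have harmonic: "2 * (p * \<bar>a\<bar>) \<le> a\<^sup>2 + k\<^sup>2" .
  have "q * p\<^sup>2 \<le> 2 * Y / \<tau>\<^sup>2"
    using q by (simp add: p_def power_divide divide_right_mono)
  moreover have "q * (2 * p * \<bar>a\<bar>) \<le> q * (p\<^sup>2 + a\<^sup>2)"
    using sum_squares_bound[of p "\<bar>a\<bar>"] q by (intro mult_left_mono) auto
  ultimately have skyrme: "q * (p * \<bar>a\<bar>) \<le> q * a\<^sup>2 / 2 + Y / \<tau>\<^sup>2"
    by (simp add: distrib_left)
  have "\<bar>s * (2 - q) * a\<bar> / \<tau> = \<bar>2 - q\<bar> * (p * \<bar>a\<bar>)"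
    by (simp add: p_def abs_mult)
  also have "\<dots> \<le> (2 + q) * (p * \<bar>a\<bar>)"
    using q p by (intro mult_right_mono) auto
  also have "\<dots> \<le> a\<^sup>2 + k\<^sup>2 + q * a\<^sup>2 / 2 + Y / \<tau>\<^sup>2"
    using harmonic skyrme by (simp add: distrib_right)
  finally show ?thesis .
qed

lemma sin_sq_le: "(sin x)\<^sup>2 \<le> 2 * (1 - cos x)" for x :: real
  using zero_le_power2[of "1 - cos x"] by (simp add: power2_diff sin_squared_eq)

lemma le_if_derivative_nonneg:
  fixes f :: "real \<Rightarrow> real"
  assumes "a \<le> b"
    and "\<And>x. x \<in> {a..b} \<Longrightarrow> \<exists>d\<ge>0. (f has_real_derivative d) (at x within {a..b})"
  shows "f a \<le> f b"
proof -
  obtain f' where f': "\<And>x. x \<in> {a..b} \<Longrightarrow> 0 \<le> f' x \<and> (f has_real_derivative f' x) (at x within {a..b})"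
    using assms(2) by metis
  then obtain x where "x \<in> {a..b}" "f b - f a = f' x * (b - a)"
    using mvt_very_simple[OF assms(1), of f "\<lambda>x. (*) (f' x)"] by (auto simp: has_field_derivative_def)
  moreover from this have "0 \<le> f' x * (b - a)" using f' assms(1) by simp
  ultimately show ?thesis by simp
qed

section \<open>Balance laws of the Skyrme equation\<close>

text \<open>\<open>k\<close> extends \<open>sin u / r\<close> to the axis \<open>r = 0\<close>, where the quotient itself would be \<open>0\<close>.\<close>

locale skyrme_cone =
  fixes \<alpha> T0 :: real and u ut ur utt utr urr k kt kr :: "real \<times> real \<Rightarrow> real"
  assumes \<alpha>_pos: "\<alpha> > 0" and T0_pos: "T0 > 0"
    and u_partials: "has_cont_partials u ut ur (Omega T0)"
    and ut_partials: "has_cont_partials ut utt utr (Omega T0)"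
    and ur_partials: "has_cont_partials ur utr urr (Omega T0)"
    and k_partials: "has_cont_partials k kt kr (Omega T0)"
    and sin_u: "z \<in> Omega T0 \<Longrightarrow> sin (u z) = snd z * k z"
    and u_axis: "0 < t \<Longrightarrow> t \<le> T0 \<Longrightarrow> u (t, 0) = 0"
    and skyrme: "z \<in> Omega T0 \<Longrightarrow> 0 < snd z \<Longrightarrow>
      snd z * (1 + \<alpha>\<^sup>2 * (k z)\<^sup>2) * (utt z - urr z) - (1 - \<alpha>\<^sup>2 * (k z)\<^sup>2) * ur z
        + k z * cos (u z) * (\<alpha>\<^sup>2 * ((ut z)\<^sup>2 - (ur z)\<^sup>2) + 1) = 0"
begin

lemmas field_continuous [continuous_intros] =
  has_cont_partials_continuous_on[OF u_partials] has_cont_partials_continuous_on[OF k_partials]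
  has_cont_partials_continuous_on(2,3)[OF ut_partials] has_cont_partials_continuous_on(2,3)[OF ur_partials]

lemmas field_has_derivative =
  u_partials[THEN has_cont_partials_has_derivative] ut_partials[THEN has_cont_partials_has_derivative]
  ur_partials[THEN has_cont_partials_has_derivative] k_partials[THEN has_cont_partials_has_derivative]

lemmas field_radial =
  has_cont_partials_Omega_radial[OF u_partials] has_cont_partials_Omega_radial[OF ut_partials]
  has_cont_partials_Omega_radial[OF ur_partials] has_cont_partials_Omega_radial[OF k_partials]

lemma k_derivatives:
  assumes r: "0 < r" "r < t" and t: "t \<le> T0"
  shows "r * kt (t, r) = cos (u (t, r)) * ut (t, r)"
    and "r * kr (t, r) = cos (u (t, r)) * ur (t, r) - k (t, r)"
proof -
  have "has_cont_partials (\<lambda>z. snd z * k z) (\<lambda>z. snd z * kt z) (\<lambda>z. snd z * kr z + k z) (Omega T0)"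
    by (rule has_cont_partialsI)
      (auto intro!: derivative_eq_intros field_has_derivative continuous_intros simp: algebra_simps)
  moreover have "has_cont_partials (\<lambda>z. sin (u z)) (\<lambda>z. cos (u z) * ut z) (\<lambda>z. cos (u z) * ur z) (Omega T0)"
    by (rule has_cont_partials_sin[OF u_partials])
  moreover have "(t, r) \<in> Omega T0" using r t by (simp add: Omega_def)
  ultimately have "snd (t, r) * kt (t, r) = cos (u (t, r)) * ut (t, r)"
    "snd (t, r) * kr (t, r) + k (t, r) = cos (u (t, r)) * ur (t, r)"
    using has_cont_partials_Omega_unique[of "\<lambda>z. snd z * k z" _ _ T0 "\<lambda>z. sin (u z)"] sin_u r(2) by fastforce+
  then show "r * kt (t, r) = cos (u (t, r)) * ut (t, r)"
    "r * kr (t, r) = cos (u (t, r)) * ur (t, r) - k (t, r)"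
    by simp_all
qed

definition q :: "real \<times> real \<Rightarrow> real" where "q z = \<alpha>\<^sup>2 * (k z)\<^sup>2"

definition energy_dens :: "real \<times> real \<Rightarrow> real" where
  "energy_dens z = snd z * ((1 + q z) * ((ut z)\<^sup>2 + (ur z)\<^sup>2) + (k z)\<^sup>2) / 2"

definition momentum_dens :: "real \<times> real \<Rightarrow> real" where
  "momentum_dens z = snd z * (1 + q z) * ut z * ur z"

definition momentum_flux :: "real \<times> real \<Rightarrow> real" where
  "momentum_flux z = snd z * ((1 + q z) * ((ut z)\<^sup>2 + (ur z)\<^sup>2) - (k z)\<^sup>2) / 2"

definition momentum_source :: "real \<times> real \<Rightarrow> real" where
  "momentum_source z = - ((1 - q z) * ((ut z)\<^sup>2 - (ur z)\<^sup>2) + (k z)\<^sup>2) / 2"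

text \<open>For the multiplier \<open>g = 3 sin u / (1 + q) - sin u\<close> one has \<open>(1 + q) g = sin u (2 - q)\<close>, so the density
  \<open>r (1 + q) u\<^sub>t g\<close> needs no division.\<close>

definition virial_dens :: "real \<times> real \<Rightarrow> real" where
  "virial_dens z = snd z * sin (u z) * (2 - q z) * ut z"

definition virial_flux :: "real \<times> real \<Rightarrow> real" where
  "virial_flux z = snd z * sin (u z) * (2 - q z) * ur z"

definition virial_source :: "real \<times> real \<Rightarrow> real" where
  "virial_source z = snd z *
     (cos (u z) * (3 / (1 + q z) - 1 - 2 * q z) * ((ut z)\<^sup>2 - (ur z)\<^sup>2)
      - cos (u z) * (2 - q z) / (1 + q z) * (k z)\<^sup>2 - 6 * q z / (1 + q z) * k z * ur z)"

lemma q_nonneg: "0 \<le> q z"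
  by (simp add: q_def)

lemma one_plus_q_pos: "0 < 1 + q z"
  using q_nonneg[of z] by simp

lemma q_continuous [continuous_intros]: "continuous_on (Omega T0) q"
  unfolding q_def[abs_def] by (intro continuous_intros)

lemma densities_continuous [continuous_intros]:
  "continuous_on (Omega T0) energy_dens" "continuous_on (Omega T0) momentum_dens"
  "continuous_on (Omega T0) momentum_flux" "continuous_on (Omega T0) momentum_source"
  "continuous_on (Omega T0) virial_dens" "continuous_on (Omega T0) virial_flux"
  unfolding energy_dens_def[abs_def] momentum_dens_def[abs_def] momentum_flux_def[abs_def]
    momentum_source_def[abs_def] virial_dens_def[abs_def] virial_flux_def[abs_def]
  by (intro continuous_intros; simp)+

lemma virial_source_continuous [continuous_intros]: "continuous_on (Omega T0) virial_source"
  unfolding virial_source_def[abs_def]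
  by (intro continuous_intros ballI less_imp_neq[OF one_plus_q_pos, symmetric])

lemma momentum_dens_partials:
  "has_cont_partials momentum_dens
    (\<lambda>z. 2 * \<alpha>\<^sup>2 * k z * (snd z * kt z) * ut z * ur z + snd z * (1 + q z) * (utt z * ur z + ut z * utr z))
    (\<lambda>z. (1 + q z) * ut z * ur z + 2 * \<alpha>\<^sup>2 * k z * (snd z * kr z) * ut z * ur z
      + snd z * (1 + q z) * (utr z * ur z + ut z * urr z)) (Omega T0)"
  unfolding momentum_dens_def[abs_def] q_def[abs_def]
  by (rule has_cont_partialsI)
    (auto intro!: derivative_eq_intros field_has_derivative continuous_intros
      simp: algebra_simps power2_eq_square)

lemma energy_balance: "balance_law T0 energy_dens momentum_dens (\<lambda>_. 0)"
proof (rule balance_lawI)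
  let ?Pt = "\<lambda>z. \<alpha>\<^sup>2 * k z * (snd z * kt z) * ((ut z)\<^sup>2 + (ur z)\<^sup>2)
      + snd z * (1 + q z) * (ut z * utt z + ur z * utr z) + k z * (snd z * kt z)"
  show "has_cont_partials energy_dens ?Pt
    (\<lambda>z. ((1 + q z) * ((ut z)\<^sup>2 + (ur z)\<^sup>2) + (k z)\<^sup>2) / 2 + \<alpha>\<^sup>2 * k z * (snd z * kr z) * ((ut z)\<^sup>2 + (ur z)\<^sup>2)
      + snd z * (1 + q z) * (ut z * utr z + ur z * urr z) + k z * (snd z * kr z)) (Omega T0)"
    unfolding energy_dens_def[abs_def] q_def[abs_def]
    by (rule has_cont_partialsI)
      (auto intro!: derivative_eq_intros field_has_derivative continuous_intros
        simp: field_simps power2_eq_square)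
  fix t r :: real assume t: "t \<le> T0" "0 < r" "r < t"
  then have cone: "(t, r) \<in> Omega T0" by (simp add: Omega_def)
  show "((\<lambda>r. momentum_dens (t, r)) has_real_derivative ?Pt (t, r) - 0) (at r)"
  proof (rule DERIV_cong[OF has_cont_partials_Omega_radial[OF momentum_dens_partials t(2,3,1)]])
    show "(1 + q (t, r)) * ut (t, r) * ur (t, r)
      + 2 * \<alpha>\<^sup>2 * k (t, r) * (snd (t, r) * kr (t, r)) * ut (t, r) * ur (t, r)
      + snd (t, r) * (1 + q (t, r)) * (utr (t, r) * ur (t, r) + ut (t, r) * urr (t, r)) = ?Pt (t, r) - 0"
      using skyrme[OF cone, unfolded snd_conv, OF t(2)]
      unfolding q_def snd_conv k_derivatives[OF t(2,3,1)] by algebra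
  qed
qed (intro continuous_intros)+

lemma momentum_balance: "balance_law T0 momentum_dens momentum_flux momentum_source"
proof (rule balance_lawI[OF _ _ momentum_dens_partials])
  fix t r :: real assume t: "t \<le> T0" "0 < r" "r < t"
  then have cone: "(t, r) \<in> Omega T0" by (simp add: Omega_def)
  let ?Pt = "2 * \<alpha>\<^sup>2 * k (t, r) * (snd (t, r) * kt (t, r)) * ut (t, r) * ur (t, r)
      + snd (t, r) * (1 + q (t, r)) * (utt (t, r) * ur (t, r) + ut (t, r) * utr (t, r))"
  let ?Qr = "((1 + q (t, r)) * ((ut (t, r))\<^sup>2 + (ur (t, r))\<^sup>2) - (k (t, r))\<^sup>2) / 2
      + \<alpha>\<^sup>2 * k (t, r) * (r * kr (t, r)) * ((ut (t, r))\<^sup>2 + (ur (t, r))\<^sup>2)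
      + r * (1 + q (t, r)) * (ut (t, r) * utr (t, r) + ur (t, r) * urr (t, r)) - k (t, r) * (r * kr (t, r))"
  have "((\<lambda>r. momentum_flux (t, r)) has_real_derivative ?Qr) (at r)"
    unfolding momentum_flux_def q_def
    by (auto intro!: derivative_eq_intros field_radial t simp: field_simps power2_eq_square)
  moreover have "?Qr = ?Pt - momentum_source (t, r)"
    using skyrme[OF cone, unfolded snd_conv, OF t(2)]
    unfolding q_def snd_conv k_derivatives[OF t(2,3,1)] momentum_source_def
    by (simp add: field_simps) algebra
  ultimately show "((\<lambda>r. momentum_flux (t, r)) has_real_derivative ?Pt - momentum_source (t, r)) (at r)"
    by (rule DERIV_cong)
qed (intro continuous_intros)+

lemma virial_balance: "balance_law T0 virial_dens virial_flux virial_source"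
proof (rule balance_lawI)
  let ?Pt = "\<lambda>z. snd z * cos (u z) * (ut z)\<^sup>2 * (2 - q z) - 2 * \<alpha>\<^sup>2 * k z * (snd z * kt z) * sin (u z) * ut z
      + snd z * sin (u z) * (2 - q z) * utt z"
  show "has_cont_partials virial_dens ?Pt
    (\<lambda>z. sin (u z) * (2 - q z) * ut z + snd z * cos (u z) * ur z * (2 - q z) * ut z
      - 2 * \<alpha>\<^sup>2 * k z * (snd z * kr z) * sin (u z) * ut z + snd z * sin (u z) * (2 - q z) * utr z) (Omega T0)"
    unfolding virial_dens_def[abs_def] q_def[abs_def]
    by (rule has_cont_partialsI)
      (auto intro!: derivative_eq_intros field_has_derivative continuous_intros
        simp: field_simps power2_eq_square)
  fix t r :: real assume t: "t \<le> T0" "0 < r" "r < t"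
  then have cone: "(t, r) \<in> Omega T0" by (simp add: Omega_def)
  let ?Qr = "sin (u (t, r)) * (2 - q (t, r)) * ur (t, r) + r * cos (u (t, r)) * (ur (t, r))\<^sup>2 * (2 - q (t, r))
      - 2 * \<alpha>\<^sup>2 * k (t, r) * (r * kr (t, r)) * sin (u (t, r)) * ur (t, r)
      + r * sin (u (t, r)) * (2 - q (t, r)) * urr (t, r)"
  have "((\<lambda>r. virial_flux (t, r)) has_real_derivative ?Qr) (at r)"
    unfolding virial_flux_def q_def
    by (auto intro!: derivative_eq_intros field_radial t simp: field_simps power2_eq_square)
  moreover have "?Qr = ?Pt (t, r) - virial_source (t, r)"
  proof -
    define w where "w = 1 / (1 + q (t, r))"
    have w: "w * (1 + \<alpha>\<^sup>2 * (k (t, r))\<^sup>2) = 1"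
      using one_plus_q_pos[of "(t, r)"] by (simp add: w_def q_def)
    have "virial_source (t, r) = r *
      (cos (u (t, r)) * (3 * w - 1 - 2 * q (t, r)) * ((ut (t, r))\<^sup>2 - (ur (t, r))\<^sup>2)
      - cos (u (t, r)) * (2 - q (t, r)) * w * (k (t, r))\<^sup>2 - 6 * q (t, r) * w * k (t, r) * ur (t, r))"
      by (simp add: virial_source_def w_def)
    then show ?thesis
      using skyrme[OF cone, unfolded snd_conv, OF t(2)] sin_u[OF cone] w
      unfolding q_def snd_conv k_derivatives[OF t(2,3,1)] by algebra
  qed
  ultimately show "((\<lambda>r. virial_flux (t, r)) has_real_derivative ?Pt (t, r) - virial_source (t, r)) (at r)"
    by (rule DERIV_cong)
qed (intro continuous_intros)+

section \<open>Energy and pointwise decay\<close>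

definition energy :: "real \<Rightarrow> real" where "energy = slice_integral energy_dens"

definition cone_flux :: "real \<Rightarrow> real" where "cone_flux t = energy_dens (t, t) + momentum_dens (t, t)"

definition skyrme_energy :: "real \<Rightarrow> real" where
  "skyrme_energy = slice_integral (\<lambda>z. snd z * (q z * (ur z)\<^sup>2))"

lemma energy_has_integral:
  assumes "0 < t" "t \<le> T0"
  shows "((\<lambda>r. energy_dens (t, r)) has_integral energy t) {0..t}"
  unfolding energy_def by (intro slice_has_integral[OF _ assms] continuous_intros)

lemma skyrme_energy_has_integral:
  assumes "0 < t" "t \<le> T0"
  shows "((\<lambda>r. r * (q (t, r) * (ur (t, r))\<^sup>2)) has_integral skyrme_energy t) {0..t}"
  unfolding skyrme_energy_def
  by (rule slice_has_integral[OF _ assms, of "\<lambda>z. snd z * (q z * (ur z)\<^sup>2)", simplified])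
    (intro continuous_intros)

lemma energy_dens_nonneg: "0 \<le> snd z \<Longrightarrow> 0 \<le> energy_dens z"
  using q_nonneg[of z] by (simp add: energy_dens_def)

lemma energy_nonneg: "0 < t \<Longrightarrow> t \<le> T0 \<Longrightarrow> 0 \<le> energy t"
  by (rule has_integral_nonneg[OF energy_has_integral]) (auto intro: energy_dens_nonneg)

lemma skyrme_energy_nonneg: "0 < t \<Longrightarrow> t \<le> T0 \<Longrightarrow> 0 \<le> skyrme_energy t"
  by (rule has_integral_nonneg[OF skyrme_energy_has_integral]) (auto simp: q_nonneg)

lemma skyrme_energy_le:
  assumes "0 < t" "t \<le> T0"
  shows "skyrme_energy t \<le> 2 * energy t"
proof (rule has_integral_le[OF skyrme_energy_has_integral[OF assms]])
  show "((\<lambda>r. 2 * energy_dens (t, r)) has_integral 2 * energy t) {0..t}"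
    by (intro has_integral_mult_right energy_has_integral assms)
  fix r assume "r \<in> {0..t}"
  then have "0 \<le> r * ((1 + q (t, r)) * (ut (t, r))\<^sup>2 + (ur (t, r))\<^sup>2 + (k (t, r))\<^sup>2)"
    using q_nonneg[of "(t, r)"] by simp
  then show "r * (q (t, r) * (ur (t, r))\<^sup>2) \<le> 2 * energy_dens (t, r)"
    by (simp add: energy_dens_def algebra_simps)
qed

lemma skyrme_energy_weighted_le:
  assumes "0 < t" "t \<le> T0" "0 < S"
  shows "t * (skyrme_energy t / (t + S)) \<le> skyrme_energy t"
  using assms skyrme_energy_nonneg[of t] by (simp add: field_simps)

lemma cone_flux_eq:
  "cone_flux t = t * ((1 + q (t, t)) * (ut (t, t) + ur (t, t))\<^sup>2 + (k (t, t))\<^sup>2) / 2"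
  by (simp add: cone_flux_def energy_dens_def momentum_dens_def field_simps power2_eq_square)

lemma cone_flux_nonneg: "0 \<le> t \<Longrightarrow> 0 \<le> cone_flux t"
  using q_nonneg[of "(t, t)"] by (simp add: cone_flux_eq)

lemma energy_has_derivative:
  assumes "0 < t" "t \<le> T0"
  shows "(energy has_real_derivative cone_flux t) (at t within {0<..T0})"
  using balance_law_has_derivative[OF energy_balance assms]
  by (simp add: energy_def cone_flux_def momentum_dens_def slice_integral_def)

lemma energy_mono:
  assumes "0 < s" "s \<le> t" "t \<le> T0"
  shows "energy s \<le> energy t"
proof (rule le_if_derivative_nonneg[where f = energy])
  fix x assume "x \<in> {s..t}"
  then show "\<exists>d\<ge>0. (energy has_real_derivative d) (at x within {s..t})"
    using assms
    by (intro exI[of _ "cone_flux x"] conjI cone_flux_nonneg DERIV_subset[OF energy_has_derivative]) auto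
qed (use assms in simp)

text \<open>Cauchy--Schwarz, applied to \<open>\<alpha> (1 - cos u) = \<integral>\<^sub>0\<^sup>r \<surd>s \<cdot> \<surd>s \<alpha> k u\<^sub>r ds\<close>.\<close>

lemma one_minus_cos_sq_le:
  assumes "(t, r) \<in> Omega T0"
  shows "\<alpha>\<^sup>2 * (1 - cos (u (t, r)))\<^sup>2 \<le> r\<^sup>2 / 2 * skyrme_energy t"
proof -
  have t: "0 < t" "t \<le> T0" and r: "0 \<le> r" "r \<le> t" using assms by (auto simp: Omega_def)
  have cone: "(t, s) \<in> Omega T0" if "s \<in> {0..r}" for s using that r t by (auto simp: Omega_def)
  define Y where "Y = integral {0..r} (\<lambda>s. s * (q (t, s) * (ur (t, s))\<^sup>2))"
  have "(\<lambda>s. s * (q (t, s) * (ur (t, s))\<^sup>2)) integrable_on {0..r}"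
    by (rule integrable_subinterval_real[OF has_integral_integrable[OF skyrme_energy_has_integral[OF t]]])
      (use r in auto)
  then have Y: "((\<lambda>s. s * (q (t, s) * (ur (t, s))\<^sup>2)) has_integral Y) {0..r}"
    unfolding Y_def by (rule integrable_integral)
  have "((\<lambda>s. - cos (u (t, s))) has_vector_derivative sin (u (t, s)) * ur (t, s)) (at s within {0..r})"
    if s: "s \<in> {0..r}" for s
  proof -
    have "((\<lambda>s. u (t, s)) has_real_derivative 0 * ut (t, s) + 1 * ur (t, s)) (at s within {0..r})"
      using cone s by (intro has_cont_partials_along_curve[OF u_partials]) auto
    then show ?thesis
      unfolding has_real_derivative_iff_has_vector_derivative[symmetric] by (auto intro!: derivative_eq_intros)
  qed
  then have "((\<lambda>s. sin (u (t, s)) * ur (t, s)) has_integral - cos (u (t, r)) - - cos (u (t, 0))) {0..r}"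
    using r by (intro fundamental_theorem_of_calculus) auto
  then have "((\<lambda>s. \<alpha> * (sin (u (t, s)) * ur (t, s))) has_integral \<alpha> * (1 - cos (u (t, r)))) {0..r}"
    using u_axis[OF t] by (intro has_integral_mult_right) simp
  then have cross: "((\<lambda>s. sqrt s * (sqrt s * (\<alpha> * k (t, s) * ur (t, s))))
      has_integral \<alpha> * (1 - cos (u (t, r)))) {0..r}"
    by (rule has_integral_eq[rotated]) (simp add: sin_u[OF cone] flip: mult.assoc)
  have "((\<lambda>s. s) has_integral r\<^sup>2 / 2) {0..r}"
    using ident_has_integral[of 0 r] r by simp
  then have weight: "((\<lambda>s. (sqrt s)\<^sup>2) has_integral r\<^sup>2 / 2) {0..r}"
    by (rule has_integral_eq[rotated]) simp
  have dirichlet: "((\<lambda>s. (sqrt s * (\<alpha> * k (t, s) * ur (t, s)))\<^sup>2) has_integral Y) {0..r}"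
    using Y by (rule has_integral_eq[rotated]) (simp add: q_def power_mult_distrib mult_ac)
  have "\<alpha>\<^sup>2 * (1 - cos (u (t, r)))\<^sup>2 \<le> r\<^sup>2 / 2 * Y"
    using has_integral_Cauchy_Schwarz[OF weight dirichlet cross] by (simp add: power_mult_distrib)
  also have "Y \<le> skyrme_energy t"
    using r by (intro has_integral_subset_le[OF _ Y skyrme_energy_has_integral[OF t]]) (auto simp: q_nonneg)
  finally show ?thesis by (simp add: mult_left_mono)
qed

lemma q_sin_sq_le:
  assumes "(t, r) \<in> Omega T0"
  shows "q (t, r) * (sin (u (t, r)))\<^sup>2 \<le> 2 * skyrme_energy t"
proof (cases "r = 0")
  case True
  then show ?thesis using assms skyrme_energy_nonneg[of t] u_axis[of t] by (auto simp: Omega_def)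
next
  case False
  then have r: "0 < r" using assms by (auto simp: Omega_def)
  have "r\<^sup>2 * (q (t, r) * (sin (u (t, r)))\<^sup>2) = \<alpha>\<^sup>2 * ((sin (u (t, r)))\<^sup>2)\<^sup>2"
    using sin_u[OF assms] by (simp add: q_def power_mult_distrib power2_eq_square)
  also have "\<dots> \<le> \<alpha>\<^sup>2 * (2 * (1 - cos (u (t, r))))\<^sup>2"
    by (intro mult_left_mono power_mono sin_sq_le) auto
  also have "\<dots> = 4 * (\<alpha>\<^sup>2 * (1 - cos (u (t, r)))\<^sup>2)" by (simp only: power_mult_distrib) simp
  also have "\<dots> \<le> r\<^sup>2 * (2 * skyrme_energy t)" using one_minus_cos_sq_le[OF assms] by (simp add: mult_ac)
  finally show ?thesis using r by simp
qed

definition decay_const :: real where "decay_const = 2 * sqrt (energy T0) / \<alpha>"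

lemma decay_const_nonneg: "0 \<le> decay_const"
  using energy_nonneg[of T0] T0_pos \<alpha>_pos by (simp add: decay_const_def)

lemma one_minus_cos_le:
  assumes "(t, r) \<in> Omega T0"
  shows "1 - cos (u (t, r)) \<le> decay_const * r / 2"
proof -
  have t: "0 < t" "t \<le> T0" and r: "0 \<le> r" using assms by (auto simp: Omega_def)
  have "(\<alpha> * (1 - cos (u (t, r))))\<^sup>2 \<le> r\<^sup>2 / 2 * skyrme_energy t"
    using one_minus_cos_sq_le[OF assms] by (simp add: power_mult_distrib)
  also have "\<dots> \<le> r\<^sup>2 / 2 * (2 * energy T0)"
    using skyrme_energy_le[OF t] energy_mono[OF t order_refl] by (intro mult_left_mono) auto
  also have "\<dots> = (r * sqrt (energy T0))\<^sup>2"
    using energy_nonneg[of T0] T0_pos by (simp add: power_mult_distrib)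
  finally have "\<alpha> * (1 - cos (u (t, r))) \<le> r * sqrt (energy T0)"
    by (rule power2_le_imp_le) (use r energy_nonneg[of T0] T0_pos in auto)
  then show ?thesis using \<alpha>_pos by (simp add: decay_const_def field_simps)
qed

lemma r_k_sq_le:
  assumes "(t, r) \<in> Omega T0"
  shows "r * (k (t, r))\<^sup>2 \<le> decay_const"
proof (cases "r = 0")
  case True
  then show ?thesis using decay_const_nonneg by simp
next
  case False
  then have r: "0 < r" using assms by (auto simp: Omega_def)
  have "r * (r * (k (t, r))\<^sup>2) = (sin (u (t, r)))\<^sup>2"
    using sin_u[OF assms] by (simp add: power_mult_distrib power2_eq_square)
  also have "\<dots> \<le> r * decay_const"
    using sin_sq_le[of "u (t, r)"] one_minus_cos_le[OF assms] by (simp add: mult.commute)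
  finally show ?thesis using r by simp
qed

section \<open>The combined multiplier\<close>

definition log_weight :: "real \<Rightarrow> real \<times> real \<Rightarrow> real" where
  "log_weight S z = ln (fst z + S) - ln (fst z + S - snd z)"

definition log_source :: "real \<Rightarrow> real \<times> real \<Rightarrow> real" where
  "log_source S z = (1 / (fst z + S) - 1 / (fst z + S - snd z)) * momentum_dens z
     - 1 / (fst z + S - snd z) * momentum_flux z + log_weight S z * momentum_source z"

text \<open>The factor 24 lets the coercive term \<open>- 12 (u\<^sub>t\<^sup>2 + q u\<^sub>r\<^sup>2)\<close> absorb the \<open>3 u\<^sub>t\<^sup>2 + 8 q u\<^sub>r\<^sup>2\<close> produced
  by the virial multiplier, leaving enough of \<open>q u\<^sub>r\<^sup>2\<close> for the Skyrme energy in the error terms.\<close>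

definition multiplier_dens :: "real \<Rightarrow> real \<times> real \<Rightarrow> real" where
  "multiplier_dens S z = 24 * (log_weight S z * momentum_dens z) + 1 / (fst z + S) * virial_dens z"

definition multiplier_flux :: "real \<Rightarrow> real \<times> real \<Rightarrow> real" where
  "multiplier_flux S z = 24 * (log_weight S z * momentum_flux z) + 1 / (fst z + S) * virial_flux z"

definition multiplier_source :: "real \<Rightarrow> real \<times> real \<Rightarrow> real" where
  "multiplier_source S z = 24 * log_source S z
     + (virial_source z - virial_dens z / (fst z + S)) / (fst z + S)"

definition multiplier_moment :: "real \<Rightarrow> real \<Rightarrow> real" where
  "multiplier_moment S = slice_integral (multiplier_dens S)"

lemma log_weight_partials:
  assumes "0 < S"
  shows "has_cont_partials (log_weight S) (\<lambda>z. 1 / (fst z + S) - 1 / (fst z + S - snd z))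
    (\<lambda>z. 1 / (fst z + S - snd z)) (Omega T0)"
proof (rule has_cont_partialsI)
  fix z assume "z \<in> Omega T0"
  then have "fst z + S > 0" "fst z + S - snd z > 0" using assms by (auto simp: Omega_def)
  then show "(log_weight S has_derivative (\<lambda>h. fst h * (1 / (fst z + S) - 1 / (fst z + S - snd z))
      + snd h * (1 / (fst z + S - snd z)))) (at z within Omega T0)"
    unfolding log_weight_def[abs_def]
    by (auto intro!: derivative_eq_intros simp: fun_eq_iff divide_inverse algebra_simps)
qed (use assms in \<open>auto intro!: continuous_intros simp: Omega_def\<close>)

lemma inverse_time_partials:
  assumes "0 < S"
  shows "has_cont_partials (\<lambda>z. 1 / (fst z + S)) (\<lambda>z. - 1 / (fst z + S)\<^sup>2) (\<lambda>_. 0) (Omega T0)"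
proof (rule has_cont_partialsI)
  fix z assume "z \<in> Omega T0"
  then have "fst z + S > 0" using assms by (auto simp: Omega_def)
  then show "((\<lambda>z. 1 / (fst z + S)) has_derivative (\<lambda>h. fst h * (- 1 / (fst z + S)\<^sup>2) + snd h * 0))
      (at z within Omega T0)"
    by (auto intro!: derivative_eq_intros simp: field_simps power2_eq_square)
qed (use assms in \<open>auto intro!: continuous_intros simp: Omega_def\<close>)

lemma multiplier_balance:
  assumes "0 < S"
  shows "balance_law T0 (multiplier_dens S) (multiplier_flux S) (multiplier_source S)"
proof -
  have "balance_law T0 (\<lambda>z. 24 * (log_weight S z * momentum_dens z))
      (\<lambda>z. 24 * (log_weight S z * momentum_flux z)) (\<lambda>z. 24 * log_source S z)"
    using balance_law_mult[OF balance_law_mult[OF momentum_balance log_weight_partials[OF assms]]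
        has_cont_partials_const[of 24]] by (simp add: log_source_def)
  moreover have "balance_law T0 (\<lambda>z. 1 / (fst z + S) * virial_dens z) (\<lambda>z. 1 / (fst z + S) * virial_flux z)
      (\<lambda>z. (virial_source z - virial_dens z / (fst z + S)) / (fst z + S))"
    using balance_law_mult[OF virial_balance inverse_time_partials[OF assms]]
    by (simp add: power2_eq_square diff_divide_distrib)
  ultimately show ?thesis
    unfolding multiplier_dens_def[abs_def] multiplier_flux_def[abs_def] multiplier_source_def[abs_def]
    by (rule balance_law_add)
qed

lemma log_source_le:
  assumes cone: "(t, r) \<in> Omega T0" and S: "0 < S"
  shows "log_source S (t, r)
    \<le> (decay_const / (t + S - r) - r * ((ut (t, r))\<^sup>2 + q (t, r) * (ur (t, r))\<^sup>2) / (t + S)) / 2"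
proof -
  have r: "0 \<le> r" "r < t + S" using assms by (auto simp: Omega_def)
  have "log_source S (t, r) \<le> (r * (k (t, r))\<^sup>2 / (t + S - r)
      - r * ((ut (t, r))\<^sup>2 + q (t, r) * (ur (t, r))\<^sup>2) / (t + S)) / 2"
    using log_source_pointwise_le[OF r q_nonneg]
    by (simp add: log_source_def log_weight_def momentum_dens_def momentum_flux_def momentum_source_def)
  also have "\<dots> \<le> (decay_const / (t + S - r) - r * ((ut (t, r))\<^sup>2 + q (t, r) * (ur (t, r))\<^sup>2) / (t + S)) / 2"
    using r_k_sq_le[OF cone] r by (intro divide_right_mono diff_right_mono) auto
  finally show ?thesis .
qed

lemma virial_source_le:
  assumes cone: "(t, r) \<in> Omega T0" and small: "decay_const * t \<le> 1"
  shows "virial_source (t, r) \<le> r * (2 * (ut (t, r))\<^sup>2 + 8 * (q (t, r) * (ur (t, r))\<^sup>2) - (ur (t, r))\<^sup>2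
    - q (t, r) * (ut (t, r))\<^sup>2 + 5 * (k (t, r))\<^sup>2)"
proof -
  have r: "0 \<le> r" "r \<le> t" using cone by (auto simp: Omega_def)
  have "decay_const * r \<le> decay_const * t" using r decay_const_nonneg by (intro mult_left_mono)
  then have "1 / 2 \<le> cos (u (t, r))" using one_minus_cos_le[OF cone] small by simp
  from virial_source_pointwise_le[OF q_nonneg this cos_le_one] r(1) show ?thesis
    by (simp add: virial_source_def mult_left_mono)
qed

lemma virial_dens_le:
  assumes cone: "(t, r) \<in> Omega T0" and S: "0 < S"
  shows "\<bar>virial_dens (t, r)\<bar> / (t + S)
    \<le> r * ((ut (t, r))\<^sup>2 + (k (t, r))\<^sup>2 + q (t, r) * (ut (t, r))\<^sup>2 / 2) + skyrme_energy t / (t + S)"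
proof -
  have t: "0 < t" "t \<le> T0" and r: "0 \<le> r" "r \<le> t + S" using assms by (auto simp: Omega_def)
  define s where "s = sin (u (t, r))"
  have "\<bar>s\<bar> \<le> (t + S) * \<bar>k (t, r)\<bar>"
    using r sin_u[OF cone] by (simp add: s_def abs_mult mult_right_mono)
  moreover have "q (t, r) * s\<^sup>2 \<le> 2 * skyrme_energy t" unfolding s_def by (rule q_sin_sq_le[OF cone])
  ultimately have bound: "\<bar>s * (2 - q (t, r)) * ut (t, r)\<bar> / (t + S)
      \<le> (ut (t, r))\<^sup>2 + (k (t, r))\<^sup>2 + q (t, r) * (ut (t, r))\<^sup>2 / 2 + skyrme_energy t / (t + S)\<^sup>2"
    using t S q_nonneg by (intro virial_dens_pointwise_le) auto
  have "\<bar>virial_dens (t, r)\<bar> / (t + S) = r * (\<bar>s * (2 - q (t, r)) * ut (t, r)\<bar> / (t + S))"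
    using r by (simp add: virial_dens_def s_def abs_mult)
  also have "\<dots> \<le> r * ((ut (t, r))\<^sup>2 + (k (t, r))\<^sup>2 + q (t, r) * (ut (t, r))\<^sup>2 / 2
      + skyrme_energy t / (t + S)\<^sup>2)"
    using r(1) by (intro mult_left_mono bound)
  also have "\<dots> = r * ((ut (t, r))\<^sup>2 + (k (t, r))\<^sup>2 + q (t, r) * (ut (t, r))\<^sup>2 / 2)
      + r * (skyrme_energy t / (t + S)\<^sup>2)"
    by (simp only: distrib_left)
  also have "r * (skyrme_energy t / (t + S)\<^sup>2) \<le> (t + S) * (skyrme_energy t / (t + S)\<^sup>2)"
    using r skyrme_energy_nonneg[OF t] by (intro mult_right_mono) auto
  also have "\<dots> = skyrme_energy t / (t + S)" by (simp add: power2_eq_square)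
  finally show ?thesis by simp
qed

lemma virial_weighted_source_le:
  assumes cone: "(t, r) \<in> Omega T0" and S: "0 < S" and small: "decay_const * t \<le> 1"
  shows "virial_source (t, r) - virial_dens (t, r) / (t + S)
    \<le> r * (3 * (ut (t, r))\<^sup>2 + 8 * (q (t, r) * (ur (t, r))\<^sup>2) - (ur (t, r))\<^sup>2
        - q (t, r) * (ut (t, r))\<^sup>2 / 2 + 6 * (k (t, r))\<^sup>2) + skyrme_energy t / (t + S)"
proof -
  have "- (virial_dens (t, r) / (t + S)) \<le> \<bar>virial_dens (t, r) / (t + S)\<bar>"
    by (rule abs_ge_minus_self)
  also have "\<dots> = \<bar>virial_dens (t, r)\<bar> / (t + S)" using cone S by (simp add: Omega_def)
  also have "\<dots> \<le> r * ((ut (t, r))\<^sup>2 + (k (t, r))\<^sup>2 + q (t, r) * (ut (t, r))\<^sup>2 / 2)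
      + skyrme_energy t / (t + S)"
    by (rule virial_dens_le[OF cone S])
  finally show ?thesis
    using virial_source_le[OF cone small] by (simp add: algebra_simps)
qed

lemma multiplier_source_le:
  assumes cone: "(t, r) \<in> Omega T0" and S: "0 < S" and small: "decay_const * t \<le> 1"
  shows "multiplier_source S (t, r)
    \<le> (- energy_dens (t, r) - 7 / 2 * (r * (q (t, r) * (ur (t, r))\<^sup>2))
        + (skyrme_energy t / (t + S) + 13 / 2 * decay_const)) / (t + S)
      + 12 * decay_const * (1 / (t + S - r))"
proof -
  have r: "0 \<le> r" "0 < t + S" using cone S by (auto simp: Omega_def)
  define a b \<kappa> where "a = r * (ut (t, r))\<^sup>2" and "b = r * (ur (t, r))\<^sup>2" and "\<kappa> = r * (k (t, r))\<^sup>2"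
  define qa qb where "qa = r * (q (t, r) * (ut (t, r))\<^sup>2)" and "qb = r * (q (t, r) * (ur (t, r))\<^sup>2)"
  note defs = a_def b_def \<kappa>_def qa_def qb_def
  have "24 * log_source S (t, r)
      \<le> 24 * ((decay_const / (t + S - r) - r * ((ut (t, r))\<^sup>2 + q (t, r) * (ur (t, r))\<^sup>2) / (t + S)) / 2)"
    by (intro mult_left_mono log_source_le cone S) simp
  also have "\<dots> = 12 * decay_const * (1 / (t + S - r)) - 12 * (a + qb) / (t + S)"
    by (simp add: defs distrib_left right_diff_distrib)
  finally have log_part: "24 * log_source S (t, r) \<le> \<dots>" .
  have virial_part: "(virial_source (t, r) - virial_dens (t, r) / (t + S)) / (t + S)
      \<le> (3 * a + 8 * qb - b - qa / 2 + 6 * \<kappa> + skyrme_energy t / (t + S)) / (t + S)"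
    using virial_weighted_source_le[OF cone S small] r
    by (intro divide_right_mono) (simp_all add: defs algebra_simps)
  have "multiplier_source S (t, r)
      \<le> (3 * a + 8 * qb - b - qa / 2 + 6 * \<kappa> + skyrme_energy t / (t + S) - 12 * (a + qb)) / (t + S)
        + 12 * decay_const * (1 / (t + S - r))"
    using log_part virial_part
    unfolding multiplier_source_def fst_conv diff_divide_distrib[of _ "12 * (a + qb)"] by linarith
  also have "\<dots> \<le> (- energy_dens (t, r) - 7 / 2 * qb
          + (skyrme_energy t / (t + S) + 13 / 2 * decay_const)) / (t + S)
        + 12 * decay_const * (1 / (t + S - r))"
  proof (intro add_right_mono divide_right_mono)
    have "energy_dens (t, r) = (a + b + qa + qb + \<kappa>) / 2"
      by (simp add: energy_dens_def defs algebra_simps)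
    moreover have "0 \<le> a" "0 \<le> b" using r by (simp_all add: defs)
    moreover have "\<kappa> \<le> decay_const" unfolding \<kappa>_def by (rule r_k_sq_le[OF cone])
    ultimately show "3 * a + 8 * qb - b - qa / 2 + 6 * \<kappa> + skyrme_energy t / (t + S) - 12 * (a + qb)
      \<le> - energy_dens (t, r) - 7 / 2 * qb + (skyrme_energy t / (t + S) + 13 / 2 * decay_const)"
      by simp
  qed (use r in simp)
  finally show ?thesis by (simp add: qb_def)
qed

lemma log_weight_nonneg: "0 < S \<Longrightarrow> 0 \<le> r \<Longrightarrow> r \<le> t \<Longrightarrow> 0 \<le> log_weight S (t, r)"
  by (simp add: log_weight_def)

lemma log_weight_boundary_has_integral:
  assumes "0 < S" "0 \<le> t"
  shows "((\<lambda>r. 1 / (t + S - r)) has_integral log_weight S (t, t)) {0..t}"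
proof -
  have "((\<lambda>r. 1 / (t + S - r)) has_integral log_weight S (t, t) - log_weight S (t, 0)) {0..t}"
    using assms unfolding log_weight_def
    by (intro fundamental_theorem_of_calculus)
      (auto intro!: derivative_eq_intros
        simp: field_simps has_real_derivative_iff_has_vector_derivative[symmetric])
  then show ?thesis by (simp add: log_weight_def)
qed

lemma multiplier_source_integral_le:
  assumes S: "0 < S" and t: "0 < t" "t \<le> T0" and small: "decay_const * t \<le> 1"
  shows "slice_integral (multiplier_source S) t
    \<le> - (energy t / (t + S)) - 5 / 2 * (skyrme_energy t / (t + S))
      + (12 * log_weight S (t, t) + 7) * decay_const"
proof -
  let ?Y = "skyrme_energy t"
  let ?bound = "\<lambda>r. (- energy_dens (t, r) - 7 / 2 * (r * (q (t, r) * (ur (t, r))\<^sup>2))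
      + (?Y / (t + S) + 13 / 2 * decay_const)) / (t + S) + 12 * decay_const * (1 / (t + S - r))"
  have "continuous_on (Omega T0) (multiplier_source S)"
    using multiplier_balance[OF S] by (auto elim: balance_lawE)
  moreover have "(?bound has_integral
      (- energy t - 7 / 2 * ?Y + t * (?Y / (t + S) + 13 / 2 * decay_const)) / (t + S)
      + 12 * decay_const * log_weight S (t, t)) {0..t}"
    using has_integral_const_real[of "?Y / (t + S) + 13 / 2 * decay_const" 0 t] S t
    by (intro has_integral_add has_integral_divide has_integral_diff has_integral_neg
        has_integral_mult_right energy_has_integral skyrme_energy_has_integral
        log_weight_boundary_has_integral) auto
  ultimately have "slice_integral (multiplier_source S) t
    \<le> (- energy t - 7 / 2 * ?Y + t * (?Y / (t + S) + 13 / 2 * decay_const)) / (t + S)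
      + 12 * decay_const * log_weight S (t, t)"
    using multiplier_source_le[OF _ S small] t by (intro slice_integral_le) (auto simp: Omega_def)
  also have "\<dots> \<le> (- energy t - 7 / 2 * ?Y + (?Y + (t + S) * (7 * decay_const))) / (t + S)
      + 12 * decay_const * log_weight S (t, t)"
  proof -
    have "t * (13 / 2 * decay_const) \<le> (t + S) * (7 * decay_const)"
      using S t decay_const_nonneg by (intro mult_mono) auto
    then have "t * (?Y / (t + S) + 13 / 2 * decay_const) \<le> ?Y + (t + S) * (7 * decay_const)"
      using skyrme_energy_weighted_le[OF t S] unfolding distrib_left by linarith
    then show ?thesis using S t by (intro add_right_mono divide_right_mono add_left_mono) auto
  qed
  also have "\<dots> = - (energy t / (t + S)) - 5 / 2 * (?Y / (t + S)) + (12 * log_weight S (t, t) + 7) * decay_const"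
  proof -
    have "(- energy t - 7 / 2 * ?Y + (?Y + \<tau> * (7 * decay_const))) / \<tau>
      = - (energy t / \<tau>) - 5 / 2 * (?Y / \<tau>) + 7 * decay_const" if "0 < \<tau>" for \<tau>
      using that by (simp add: field_simps)
    from this[of "t + S"] show ?thesis using S t by (simp add: distrib_right)
  qed
  finally show ?thesis .
qed

lemma multiplier_boundary_le:
  assumes S: "0 < S" "S \<le> t" and t: "t \<le> T0"
  shows "multiplier_dens S (t, t) + multiplier_flux S (t, t)
    \<le> (24 * log_weight S (t, t) + 3) * cone_flux t + 2 * (skyrme_energy t / (t + S))"
proof -
  have cone: "(t, t) \<in> Omega T0" and t: "0 < t" "t \<le> T0" using assms by (auto simp: Omega_def)
  define p s \<kappa> where "p = ut (t, t) + ur (t, t)" and "s = sin (u (t, t))" and "\<kappa> = k (t, t)"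
  have flux: "cone_flux t = t * ((1 + q (t, t)) * p\<^sup>2 + \<kappa>\<^sup>2) / 2"
    by (simp add: cone_flux_eq p_def \<kappa>_def)
  have s: "s = t * \<kappa>" "q (t, t) * s\<^sup>2 \<le> 2 * skyrme_energy t"
    using sin_u[OF cone] q_sin_sq_le[OF cone] by (simp_all add: s_def \<kappa>_def)
  have "momentum_dens (t, t) + momentum_flux (t, t) \<le> cone_flux t"
    using t by (simp add: cone_flux_def energy_dens_def momentum_flux_def divide_right_mono mult_left_mono)
  then have log_part: "log_weight S (t, t) * (momentum_dens (t, t) + momentum_flux (t, t))
      \<le> log_weight S (t, t) * cone_flux t"
    using log_weight_nonneg[of S t t] S t by (intro mult_left_mono) auto
  have "(virial_dens (t, t) + virial_flux (t, t)) / (t + S) \<le> \<bar>t * (s * (2 - q (t, t)) * p)\<bar> / (t + S)"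
    using S t
    by (intro divide_right_mono)
      (auto simp: virial_dens_def virial_flux_def p_def s_def algebra_simps abs_le_iff)
  also have "\<dots> \<le> \<bar>t * (s * (2 - q (t, t)) * p)\<bar> / t"
    using S t by (intro divide_left_mono) auto
  also have "\<dots> = t * (\<bar>s * (2 - q (t, t)) * p\<bar> / t)"
    using t by (simp add: abs_mult)
  also have "\<dots> \<le> t * (p\<^sup>2 + \<kappa>\<^sup>2 + q (t, t) * p\<^sup>2 / 2 + skyrme_energy t / t\<^sup>2)"
    using t s q_nonneg by (intro mult_left_mono virial_dens_pointwise_le) (auto simp: abs_mult)
  also have "\<dots> = t * (p\<^sup>2 + \<kappa>\<^sup>2 + q (t, t) * p\<^sup>2 / 2) + skyrme_energy t / t"
    using t by (simp add: distrib_left power2_eq_square)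
  also have "\<dots> \<le> 3 * cone_flux t + 2 * (skyrme_energy t / (t + S))"
  proof (rule add_mono)
    have "0 \<le> t * (p\<^sup>2 / 2 + q (t, t) * p\<^sup>2 + \<kappa>\<^sup>2 / 2)"
      using t q_nonneg by simp
    then show "t * (p\<^sup>2 + \<kappa>\<^sup>2 + q (t, t) * p\<^sup>2 / 2) \<le> 3 * cone_flux t"
      by (simp add: flux algebra_simps)
    have "skyrme_energy t * S \<le> skyrme_energy t * t"
      using S skyrme_energy_nonneg[OF t] by (intro mult_left_mono)
    then show "skyrme_energy t / t \<le> 2 * (skyrme_energy t / (t + S))" using S t by (simp add: field_simps)
  qed
  finally show ?thesis
    using log_part by (simp add: multiplier_dens_def multiplier_flux_def algebra_simps add_divide_distrib)
qed

lemma multiplier_moment_derivative_le: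
  assumes S: "0 < S" "S \<le> t" and t: "t \<le> T0" "decay_const * t \<le> 1"
  obtains d where "(multiplier_moment S has_real_derivative d) (at t within {0<..T0})"
    "d \<le> (24 * log_weight S (t, t) + 3) * cone_flux t - energy t / (t + S)
      + (12 * log_weight S (t, t) + 7) * decay_const"
proof
  have t0: "0 < t" using S by simp
  have "multiplier_flux S (t, 0) = 0"
    by (simp add: multiplier_flux_def momentum_flux_def virial_flux_def)
  then show "(multiplier_moment S has_real_derivative
      multiplier_dens S (t, t) + multiplier_flux S (t, t) + slice_integral (multiplier_source S) t)
      (at t within {0<..T0})"
    using balance_law_has_derivative[OF multiplier_balance[OF S(1)] t0 t(1)]
    by (simp add: multiplier_moment_def)
  have "0 \<le> skyrme_energy t / (t + S)" using skyrme_energy_nonneg[OF t0 t(1)] S t0 by simp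
  then show "multiplier_dens S (t, t) + multiplier_flux S (t, t) + slice_integral (multiplier_source S) t
    \<le> (24 * log_weight S (t, t) + 3) * cone_flux t - energy t / (t + S)
      + (12 * log_weight S (t, t) + 7) * decay_const"
    using multiplier_boundary_le[OF S t(1)] multiplier_source_integral_le[OF S(1) t0 t]
    by linarith
qed

lemma abs_momentum_dens_le:
  assumes "0 \<le> snd z"
  shows "\<bar>momentum_dens z\<bar> \<le> energy_dens z"
proof -
  have "\<bar>ut z * ur z\<bar> \<le> ((ut z)\<^sup>2 + (ur z)\<^sup>2) / 2"
    using sum_squares_bound[of "\<bar>ut z\<bar>" "\<bar>ur z\<bar>"] by (simp add: abs_mult)
  then have "snd z * (1 + q z) * \<bar>ut z * ur z\<bar> \<le> snd z * (1 + q z) * (((ut z)\<^sup>2 + (ur z)\<^sup>2) / 2)"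
    using assms one_plus_q_pos[of z] by (intro mult_left_mono) auto
  also have "\<dots> \<le> energy_dens z"
    using assms by (simp add: energy_dens_def algebra_simps)
  finally show ?thesis
    using assms one_plus_q_pos[of z] by (simp add: momentum_dens_def abs_mult mult.assoc)
qed

lemma abs_multiplier_dens_le:
  assumes cone: "(t, r) \<in> Omega T0" and S: "0 < S"
  shows "\<bar>multiplier_dens S (t, r)\<bar>
    \<le> (24 * log_weight S (t, r) + 2) * energy_dens (t, r) + skyrme_energy t / (t + S)"
proof -
  have r: "0 \<le> r" "r \<le> t" "0 < t + S" using assms by (auto simp: Omega_def)
  have "\<bar>log_weight S (t, r) * momentum_dens (t, r)\<bar> \<le> log_weight S (t, r) * energy_dens (t, r)"
    using log_weight_nonneg[OF S r(1,2)] abs_momentum_dens_le[of "(t, r)"] r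
    by (simp add: abs_mult mult_left_mono)
  moreover have "0 \<le> r * ((ur (t, r))\<^sup>2 + q (t, r) * ((ut (t, r))\<^sup>2 / 2 + (ur (t, r))\<^sup>2))"
    using r q_nonneg by simp
  then have "r * ((ut (t, r))\<^sup>2 + (k (t, r))\<^sup>2 + q (t, r) * (ut (t, r))\<^sup>2 / 2) \<le> 2 * energy_dens (t, r)"
    by (simp add: energy_dens_def algebra_simps)
  then have "\<bar>virial_dens (t, r)\<bar> / (t + S) \<le> 2 * energy_dens (t, r) + skyrme_energy t / (t + S)"
    using virial_dens_le[OF cone S] by linarith
  moreover have "\<bar>multiplier_dens S (t, r)\<bar>
      \<le> 24 * \<bar>log_weight S (t, r) * momentum_dens (t, r)\<bar> + \<bar>virial_dens (t, r)\<bar> / (t + S)"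
    using r(3) abs_triangle_ineq[of "24 * (log_weight S (t, r) * momentum_dens (t, r))"
        "virial_dens (t, r) / (t + S)"]
    by (simp add: multiplier_dens_def abs_mult)
  ultimately show ?thesis by (simp add: distrib_right)
qed

lemma abs_multiplier_moment_le:
  assumes S: "0 < S" and t: "0 < t" "t \<le> T0"
    and g: "(g has_integral I) {0..t}"
      "\<And>r. 0 \<le> r \<Longrightarrow> r \<le> t \<Longrightarrow> log_weight S (t, r) * energy_dens (t, r) \<le> g r"
  shows "\<bar>multiplier_moment S t\<bar> \<le> 24 * I + 4 * energy t"
proof -
  let ?bound = "\<lambda>r. 24 * g r + 2 * energy_dens (t, r) + skyrme_energy t / (t + S)"
  have "continuous_on (Omega T0) (multiplier_dens S)"
    using multiplier_balance[OF S] by (auto elim: balance_lawE dest: has_cont_partials_continuous_on(1))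
  then have moment: "((\<lambda>r. multiplier_dens S (t, r)) has_integral multiplier_moment S t) {0..t}"
    unfolding multiplier_moment_def by (rule slice_has_integral[OF _ t])
  have bound: "(?bound has_integral 24 * I + 2 * energy t + t * (skyrme_energy t / (t + S))) {0..t}"
    using has_integral_const_real[of "skyrme_energy t / (t + S)" 0 t] t
    by (intro has_integral_add has_integral_mult_right g energy_has_integral) auto
  have "norm (integral {0..t} (\<lambda>r. multiplier_dens S (t, r))) \<le> integral {0..t} ?bound"
  proof (rule integral_norm_bound_integral)
    fix r assume "r \<in> {0..t}"
    then have r: "0 \<le> r" "r \<le> t" "(t, r) \<in> Omega T0" using t by (auto simp: Omega_def)
    show "norm (multiplier_dens S (t, r)) \<le> ?bound r"
      using abs_multiplier_dens_le[OF r(3) S] g(2)[OF r(1,2)] by (simp add: distrib_right)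
  qed (rule has_integral_integrable[OF moment] has_integral_integrable[OF bound])+
  then have "\<bar>multiplier_moment S t\<bar> \<le> 24 * I + 2 * energy t + t * (skyrme_energy t / (t + S))"
    using moment bound by (simp add: integral_unique)
  then show ?thesis
    using skyrme_energy_weighted_le[OF t S] skyrme_energy_le[OF t] by linarith
qed

lemma abs_multiplier_moment_start_le:
  assumes S: "0 < S" "S \<le> T0"
  shows "\<bar>multiplier_moment S S\<bar> \<le> 28 * energy S"
proof -
  have "log_weight S (S, r) * energy_dens (S, r) \<le> energy_dens (S, r)" if r: "0 \<le> r" "r \<le> S" for r
  proof -
    have "log_weight S (S, r) \<le> ln (2 * S) - ln S" using r S by (simp add: log_weight_def)
    also have "\<dots> = ln 2" using S by (simp add: ln_mult)
    also have "\<dots> \<le> 1" using ln_2_less_1 by simp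
    finally show ?thesis
      using mult_right_mono[of _ 1 "energy_dens (S, r)"] energy_dens_nonneg[of "(S, r)"] r by simp
  qed
  from abs_multiplier_moment_le[OF S(1) S energy_has_integral[OF S] this] show ?thesis by simp
qed

lemma log_weight_has_integral:
  assumes S: "0 < S" and t: "0 \<le> t"
  shows "((\<lambda>r. log_weight S (t, r)) has_integral t - S * log_weight S (t, t)) {0..t}"
proof -
  define \<tau> where "\<tau> = t + S"
  define F where "F r = r * ln \<tau> + (\<tau> - r) * ln (\<tau> - r) + r" for r
  have "((\<lambda>r. log_weight S (t, r)) has_integral F t - F 0) {0..t}"
  proof (rule fundamental_theorem_of_calculus)
    fix r assume "r \<in> {0..t}"
    then have "\<tau> - r > 0" using S by (simp add: \<tau>_def)
    then have "(F has_real_derivative log_weight S (t, r)) (at r)"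
      unfolding log_weight_def F_def[abs_def] fst_conv snd_conv \<tau>_def[symmetric]
      by (auto intro!: derivative_eq_intros)
    then show "(F has_vector_derivative log_weight S (t, r)) (at r within {0..t})"
      by (simp add: has_real_derivative_iff_has_vector_derivative has_vector_derivative_at_within)
  qed (use t in simp)
  moreover have "F t - F 0 = t - S * log_weight S (t, t)"
    by (simp add: F_def \<tau>_def log_weight_def algebra_simps)
  ultimately show ?thesis by simp
qed

lemma abs_multiplier_moment_end_le:
  assumes T: "0 < T" "T \<le> T0"
  obtains K where "\<And>S. 0 < S \<Longrightarrow> \<bar>multiplier_moment S T\<bar> \<le> K"
proof -
  have "compact ((\<lambda>r. energy_dens (T, r)) ` {0..T})"
    by (intro compact_continuous_image continuous_on_slice[OF _ T] densities_continuous) simp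
  then obtain B where B: "\<And>r. r \<in> {0..T} \<Longrightarrow> energy_dens (T, r) \<le> B"
    by (metis abs_le_D1 bounded_real compact_imp_bounded imageI)
  have "0 \<le> B" using B[of 0] T by (simp add: energy_dens_def)
  have "\<bar>multiplier_moment S T\<bar> \<le> 24 * (B * T) + 4 * energy T" if S: "0 < S" for S
  proof -
    have "((\<lambda>r. B * log_weight S (T, r)) has_integral B * (T - S * log_weight S (T, T))) {0..T}"
      using S T by (intro has_integral_mult_right log_weight_has_integral) auto
    moreover have "log_weight S (T, r) * energy_dens (T, r) \<le> B * log_weight S (T, r)" if "0 \<le> r" "r \<le> T" for r
      using mult_left_mono[OF B log_weight_nonneg[OF S that]] that by (simp add: mult.commute)
    ultimately have "\<bar>multiplier_moment S T\<bar> \<le> 24 * (B * (T - S * log_weight S (T, T))) + 4 * energy T"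
      by (rule abs_multiplier_moment_le[OF S T])
    also have "B * (T - S * log_weight S (T, T)) \<le> B * T"
      using \<open>0 \<le> B\<close> S T log_weight_nonneg[of S T T] by (intro mult_left_mono) auto
    finally show ?thesis by simp
  qed
  then show thesis by (rule that)
qed

section \<open>Decay of the energy\<close>

lemma log_averaged_energy_le:
  assumes S: "0 < S" "S \<le> T" and T: "T \<le> T0" "decay_const * T \<le> 1"
    and E0: "\<And>t. 0 < t \<Longrightarrow> t \<le> T0 \<Longrightarrow> E0 \<le> energy t"
  defines "\<Lambda> \<equiv> ln (T + S) - ln S"
  shows "E0 * (ln (T + S) - ln (S + S)) \<le> (24 * \<Lambda> + 3) * (energy T - energy S)
    + (12 * \<Lambda> + 7) * decay_const * (T - S) + (multiplier_moment S S - multiplier_moment S T)"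
proof -
  define V where "V t = (24 * \<Lambda> + 3) * energy t + (12 * \<Lambda> + 7) * decay_const * t
      - E0 * ln (t + S) - multiplier_moment S t" for t
  have "V S \<le> V T"
  proof (rule le_if_derivative_nonneg[where f = V])
    fix t assume "t \<in> {S..T}"
    then have t: "S \<le> t" "t \<le> T" "0 < t" "t \<le> T0" using S T by auto
    have "decay_const * t \<le> 1"
      using mult_left_mono[OF t(2) decay_const_nonneg] T(2) by simp
    from multiplier_moment_derivative_le[OF S(1) t(1,4) this] obtain d
      where moment: "(multiplier_moment S has_real_derivative d) (at t within {0<..T0})"
        and d: "d \<le> (24 * log_weight S (t, t) + 3) * cone_flux t - energy t / (t + S)
          + (12 * log_weight S (t, t) + 7) * decay_const" .
    have "((\<lambda>t. V t) has_real_derivative (24 * \<Lambda> + 3) * cone_flux t + (12 * \<Lambda> + 7) * decay_const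
        - E0 / (t + S) - d) (at t within {S..T})"
      unfolding V_def using S t T
      by (auto intro!: derivative_eq_intros DERIV_subset[OF moment] DERIV_subset[OF energy_has_derivative])
    moreover have "0 \<le> (24 * \<Lambda> + 3) * cone_flux t + (12 * \<Lambda> + 7) * decay_const - E0 / (t + S) - d"
    proof -
      have weight: "log_weight S (t, t) \<le> \<Lambda>" using S t by (simp add: log_weight_def \<Lambda>_def)
      then have "(24 * log_weight S (t, t) + 3) * cone_flux t \<le> (24 * \<Lambda> + 3) * cone_flux t"
        using cone_flux_nonneg t by (intro mult_right_mono) auto
      moreover have "(12 * log_weight S (t, t) + 7) * decay_const \<le> (12 * \<Lambda> + 7) * decay_const"
        using weight decay_const_nonneg by (intro mult_right_mono) auto
      moreover have "E0 / (t + S) \<le> energy t / (t + S)"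
        using E0[OF t(3,4)] S t by (intro divide_right_mono) auto
      ultimately show ?thesis using d by linarith
    qed
    ultimately show "\<exists>d\<ge>0. (V has_real_derivative d) (at t within {S..T})" by blast
  qed (use S in simp)
  then show ?thesis by (simp add: V_def algebra_simps)
qed

lemma energy_lower_bound_le:
  assumes T: "0 < T" "T \<le> T0" "decay_const * T \<le> 1"
    and E0: "0 \<le> E0" "\<And>t. 0 < t \<Longrightarrow> t \<le> T0 \<Longrightarrow> E0 \<le> energy t"
  shows "E0 \<le> 24 * (energy T - E0) + 12 * decay_const * T"
proof (rule ccontr)
  define B where "B = 24 * (energy T - E0) + 12 * decay_const * T"
  assume "\<not> ?thesis"
  then have B: "0 < E0 - B" by (simp add: B_def)
  obtain K where K: "\<And>S. 0 < S \<Longrightarrow> \<bar>multiplier_moment S T\<bar> \<le> K"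
    using abs_multiplier_moment_end_le[OF T(1,2)] by blast
  define M where "M = 3 * (energy T - E0) + 7 * decay_const * T + 28 * energy T + K + E0 * ln 2"
  have bounded: "(ln (T + S) - ln S) * (E0 - B) \<le> M" if S: "0 < S" "S \<le> T" for S
  proof -
    define \<Lambda> where "\<Lambda> = ln (T + S) - ln S"
    have \<Lambda>: "0 \<le> \<Lambda>" using S by (simp add: \<Lambda>_def)
    have ES: "E0 \<le> energy S" "energy S \<le> energy T" using E0(2) energy_mono S T by auto
    have "E0 * (\<Lambda> - ln 2) = E0 * (ln (T + S) - ln (S + S))"
      using S ln_mult[of 2 S] by (simp add: \<Lambda>_def)
    also have "\<dots> \<le> (24 * \<Lambda> + 3) * (energy T - energy S) + (12 * \<Lambda> + 7) * decay_const * (T - S)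
        + (multiplier_moment S S - multiplier_moment S T)"
      unfolding \<Lambda>_def by (rule log_averaged_energy_le[OF S T(2,3) E0(2)])
    also have "\<dots> \<le> (24 * \<Lambda> + 3) * (energy T - E0) + (12 * \<Lambda> + 7) * decay_const * T + (28 * energy T + K)"
    proof (intro add_mono mult_left_mono)
      show "multiplier_moment S S - multiplier_moment S T \<le> 28 * energy T + K"
        using abs_multiplier_moment_start_le[of S] K[OF S(1)] ES S T by simp
    qed (use S \<Lambda> ES decay_const_nonneg in auto)
    finally show ?thesis by (simp add: M_def B_def \<Lambda>_def algebra_simps)
  qed
  have "filterlim (\<lambda>S. ln (T + S) - ln S) at_top (at_right 0)" using T(1) by real_asymp
  then have "filterlim (\<lambda>S. (ln (T + S) - ln S) * (E0 - B)) at_top (at_right 0)"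
    by (rule filterlim_at_top_mult_tendsto_pos[OF tendsto_const B])
  then have "\<forall>\<^sub>F S in at_right 0. M < (ln (T + S) - ln S) * (E0 - B)"
    by (simp add: filterlim_at_top_dense)
  moreover have "\<forall>\<^sub>F S in at_right 0. 0 < S \<and> S \<le> T"
    using T(1) by (auto simp: eventually_at_right_field intro!: exI[of _ T])
  ultimately have "\<forall>\<^sub>F S::real in at_right 0. False"
    by eventually_elim (use bounded in force)
  then show False by simp
qed

lemma energy_tendsto_0: "(energy \<longlongrightarrow> 0) (at_right 0)"
proof -
  define E0 where "E0 = (INF t\<in>{0<..T0}. energy t)"
  have bdd: "bdd_below (energy ` {0<..T0})" using energy_nonneg by (intro bdd_belowI2[of _ 0]) auto
  have lower: "E0 \<le> energy t" if "0 < t" "t \<le> T0" for t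
    unfolding E0_def using bdd that by (intro cINF_lower) auto
  have nonneg: "0 \<le> E0"
    unfolding E0_def using energy_nonneg T0_pos by (intro cINF_greatest) auto
  have limit: "(energy \<longlongrightarrow> E0) (at_right 0)"
  proof (rule decreasing_tendsto)
    show "\<forall>\<^sub>F t in at_right 0. E0 \<le> energy t"
      using T0_pos lower by (auto simp: eventually_at_right_field intro!: exI[of _ T0])
    fix x assume "E0 < x"
    then obtain s where "0 < s" "s \<le> T0" "energy s < x"
      unfolding E0_def using T0_pos bdd by (auto simp: cINF_less_iff)
    then show "\<forall>\<^sub>F t in at_right 0. energy t < x"
      using energy_mono
      by (auto simp: eventually_at_right_field intro!: exI[of _ s] le_less_trans[of _ "energy s" x])
  qed
  have "((\<lambda>T. decay_const * T) \<longlongrightarrow> 0) (at_right 0)"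
    by (auto intro!: tendsto_eq_intros)
  then have "\<forall>\<^sub>F T in at_right 0. decay_const * T < 1" by (rule order_tendstoD) simp
  moreover have "\<forall>\<^sub>F T in at_right 0. 0 < T \<and> T \<le> T0"
    using T0_pos by (auto simp: eventually_at_right_field intro!: exI[of _ T0])
  ultimately have "\<forall>\<^sub>F T in at_right 0. E0 \<le> 24 * (energy T - E0) + 12 * decay_const * T"
    by eventually_elim (use energy_lower_bound_le[OF _ _ _ nonneg lower] in auto)
  moreover have "((\<lambda>T. 24 * (energy T - E0) + 12 * decay_const * T)
      \<longlongrightarrow> 24 * (E0 - E0) + 12 * decay_const * 0) (at_right 0)"
    by (intro tendsto_intros limit)
  ultimately have "E0 \<le> 24 * (E0 - E0) + 12 * decay_const * 0"
    by (intro tendsto_lowerbound) auto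
  with nonneg have "E0 = 0" by simp
  with limit show ?thesis by simp
qed

end

section \<open>Smooth solutions\<close>

lemma skyrme_eq_cleared:
  assumes "skyrme_eq \<alpha> u t r" and r: "0 < r" and k: "sin (u t r) = r * k"
  shows "r * (1 + \<alpha>\<^sup>2 * k\<^sup>2) * (dt (dt u) t r - dr (dr u) t r) - (1 - \<alpha>\<^sup>2 * k\<^sup>2) * dr u t r
    + k * cos (u t r) * (\<alpha>\<^sup>2 * ((dt u t r)\<^sup>2 - (dr u t r)\<^sup>2) + 1) = 0"
proof -
  have "(1 + \<alpha>\<^sup>2 * k\<^sup>2) * (dt (dt u) t r - dr (dr u) t r) - (1 - \<alpha>\<^sup>2 * k\<^sup>2) * dr u t r / r
      + k * cos (u t r) / r * (\<alpha>\<^sup>2 * ((dt u t r)\<^sup>2 - (dr u t r)\<^sup>2) + 1) = 0"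
    using assms(1) r unfolding skyrme_eq_def sin_double k
    by (simp add: power_mult_distrib power2_eq_square mult.assoc)
  moreover have "r * X * D - Y * b + Z * W = 0" if "X * D - Y * b / r + Z / r * W = 0" for X Y Z W D b
    using that r by (simp add: field_simps)
  ultimately show ?thesis by blast
qed

lemma energy_density_eq:
  assumes r: "0 < r" and k: "sin (u t r) = r * k"
  shows "energy_density \<alpha> u t r = ((1 + \<alpha>\<^sup>2 * k\<^sup>2) * ((dt u t r)\<^sup>2 + (dr u t r)\<^sup>2) + k\<^sup>2) / 2"
  using r by (simp add: energy_density_def k power_mult_distrib add_divide_distrib)

lemma sin_division:
  assumes u: "has_cont_partials u ut ur (Omega T)" and ur: "has_cont_partials ur utr urr (Omega T)"
    and axis: "\<And>t. 0 < t \<Longrightarrow> t \<le> T \<Longrightarrow> u (t, 0) = 0"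
  obtains k kt kr where "has_cont_partials k kt kr (Omega T)"
    "\<And>t r. (t, r) \<in> Omega T \<Longrightarrow> r * k (t, r) = sin (u (t, r))"
proof (rule hadamard_division)
  show "has_cont_partials (\<lambda>z. sin (u z)) (\<lambda>z. cos (u z) * ut z) (\<lambda>z. cos (u z) * ur z) (Omega T)"
    by (rule has_cont_partials_sin[OF u])
  have "has_cont_partials (\<lambda>z. cos (u z)) (\<lambda>z. - sin (u z) * ut z) (\<lambda>z. - sin (u z) * ur z) (Omega T)"
    by (intro has_cont_partials_compose[OF u] DERIV_cos continuous_intros has_cont_partials_continuous_on[OF u])
  from has_cont_partials_mult[OF this ur]
  show "has_cont_partials (\<lambda>z. cos (u z) * ur z) (\<lambda>z. - sin (u z) * ut z * ur z + cos (u z) * utr z)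
      (\<lambda>z. - sin (u z) * ur z * ur z + cos (u z) * urr z) (Omega T)" .
  fix x y \<theta> :: real assume "(x, y) \<in> Omega T" "0 \<le> \<theta>" "\<theta> \<le> 1"
  then show "(x, \<theta> * y) \<in> Omega T"
    using mult_left_le_one_le[of y \<theta>] by (auto simp: Omega_def)
qed (use convex_Omega axis that in \<open>auto simp: Omega_def\<close>)

lemma skyrme_cone_exists:
  fixes \<alpha> T0 :: real and u :: "real \<Rightarrow> real \<Rightarrow> real"
  assumes pos: "\<alpha> > 0" "T0 > 0" and smooth: "smooth_on_set u (Omega T0)"
    and eq: "\<And>t r. (t, r) \<in> Omega T0 \<Longrightarrow> r > 0 \<Longrightarrow> skyrme_eq \<alpha> u t r"
    and axis: "\<And>t. 0 < t \<Longrightarrow> t \<le> T0 \<Longrightarrow> u t 0 = 0"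
  obtains ut ur utt utr urr k kt kr
  where "skyrme_cone \<alpha> T0 (\<lambda>(t, r). u t r) ut ur utt utr urr k kt kr"
    "\<And>t r. (t, r) \<in> Omega T0 \<Longrightarrow> dt u t r = ut (t, r)"
    "\<And>t r. (t, r) \<in> Omega T0 \<Longrightarrow> dr u t r = ur (t, r)"
proof -
  obtain U ut ur utt utr urr where U: "open U" "Omega T0 \<subseteq> U"
    and u: "has_cont_partials (\<lambda>(t, r). u t r) ut ur U"
    and ut: "has_cont_partials ut utt utr U" and ur: "has_cont_partials ur utr urr U"
    using smooth by (rule smooth_on_set_cont_partials)
  note first = dt_dr_eq_partials[OF u U(1)]
  have "has_cont_partials (\<lambda>(t, r). dt u t r) utt utr U" "has_cont_partials (\<lambda>(t, r). dr u t r) utr urr U"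
    using first by (auto intro: has_cont_partials_cong[OF ut] has_cont_partials_cong[OF ur])
  then have second: "dt (dt u) t r = utt (t, r)" "dr (dr u) t r = urr (t, r)" if "(t, r) \<in> U" for t r
    using dt_dr_eq_partials U(1) that by blast+
  note on_cone = u[THEN has_cont_partials_subset, OF U(2)] ut[THEN has_cont_partials_subset, OF U(2)]
    ur[THEN has_cont_partials_subset, OF U(2)]
  obtain k kt kr where k: "has_cont_partials k kt kr (Omega T0)"
    and sin_u: "\<And>t r. (t, r) \<in> Omega T0 \<Longrightarrow> r * k (t, r) = sin (u t r)"
    using sin_division[OF on_cone(1,3)] axis by auto
  have "skyrme_cone \<alpha> T0 (\<lambda>(t, r). u t r) ut ur utt utr urr k kt kr"
  proof
    fix z assume z: "z \<in> Omega T0"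
    obtain t r where tr: "z = (t, r)" by (cases z)
    show "sin (case z of (t, r) \<Rightarrow> u t r) = snd z * k z" using sin_u z tr by simp
    assume "0 < snd z"
    then show "snd z * (1 + \<alpha>\<^sup>2 * (k z)\<^sup>2) * (utt z - urr z) - (1 - \<alpha>\<^sup>2 * (k z)\<^sup>2) * ur z
        + k z * cos (case z of (t, r) \<Rightarrow> u t r) * (\<alpha>\<^sup>2 * ((ut z)\<^sup>2 - (ur z)\<^sup>2) + 1) = 0"
      using skyrme_eq_cleared[OF eq, of t r "k z"] sin_u[of t r] z U(2) first[of t r] second[of t r] tr by auto
  qed (use pos on_cone k axis in auto)
  then show thesis using first U(2) by (intro that) auto
qed

theorem theorem1:
  fixes \<alpha> T0 :: real and u :: "real \<Rightarrow> real \<Rightarrow> real"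
  assumes "\<alpha> > 0" and "T0 > 0"
    and "smooth_on_set u (Omega T0)"
    and "\<And>t r. (t, r) \<in> Omega T0 \<Longrightarrow> r > 0 \<Longrightarrow> skyrme_eq \<alpha> u t r"
    and "\<And>t. 0 < t \<Longrightarrow> t \<le> T0 \<Longrightarrow> u t 0 = 0"
  shows "((\<lambda>T. integral {0..T} (\<lambda>r. energy_density \<alpha> u T r * r)) \<longlongrightarrow> 0) (at_right 0)"
proof -
  obtain ut ur utt utr urr k kt kr
    where "skyrme_cone \<alpha> T0 (\<lambda>(t, r). u t r) ut ur utt utr urr k kt kr"
      and first: "\<And>t r. (t, r) \<in> Omega T0 \<Longrightarrow> dt u t r = ut (t, r)"
        "\<And>t r. (t, r) \<in> Omega T0 \<Longrightarrow> dr u t r = ur (t, r)"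
    using skyrme_cone_exists[OF assms] by blast
  then interpret skyrme_cone \<alpha> T0 "\<lambda>(t, r). u t r" ut ur utt utr urr k kt kr by blast
  have "energy_density \<alpha> u t r * r = energy_dens (t, r)" if cone: "(t, r) \<in> Omega T0" for t r
  proof (cases "r = 0")
    case False
    then have "0 < r" using cone by (simp add: Omega_def)
    then show ?thesis
      using energy_density_eq[of r u t "k (t, r)"] sin_u[OF cone] first[OF cone]
      by (simp add: energy_dens_def q_def)
  qed (simp add: energy_dens_def)
  then have "energy T = integral {0..T} (\<lambda>r. energy_density \<alpha> u T r * r)" if "0 < T" "T < T0" for T
    unfolding energy_def slice_integral_def using that by (intro integral_cong) (auto simp: Omega_def)
  then have "\<forall>\<^sub>F T in at_right 0. energy T = integral {0..T} (\<lambda>r. energy_density \<alpha> u T r * r)"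
    using T0_pos by (auto simp: eventually_at_right_field)
  with energy_tendsto_0 show ?thesis by (rule Lim_transform_eventually)
qed

end
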